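(* Let $d\ge2$, let $\mathcal{O}\subset\mathbb{R}^d$ be an open, bounded domain with smooth boundary and outer unit normal $\nu$ on $\partial\mathcal{O}$, let $N\ge1$, and let $b_1,\dots,b_N\in C^2(\overline{\mathcal{O}};\mathbb{R}^d)$ satisfy conditions (i)–(iv) listed in the context. Let $u\in C^3(\overline{\mathcal{O}})$ be a scalar function with $\langle\nabla u,\nu\rangle=0$ on $\partial\mathcal{O}$. Then $\langle\nabla(\langle b_i,\nabla u\rangle),\nu\rangle=0$ on $\partial\mathcal{O}$ for every $1\le i\le N$.
   Context: $\langle\cdot,\cdot\rangle$ is the Euclidean scalar product of $\mathbb{R}^d$ and $b_i=(b_i^1,\dots,b_i^d)$. Conditions: (i) $\langle b_i,\nu\rangle=0$ on $\partial\mathcal{O}$ for all $1\le i\le N$. (ii) Either $N=1$, or $b_i^k\partial_kb_l^j=b_l^k\partial_kb_i^j$ on $\overline{\mathcal{O}}$ for all $1\le k,j\le d$ and all $1\le i,l\le N$, $i\ne l$. (iii) $\operatorname{div}b_i=0$ and $\langle\Delta b_i,b_i\rangle=0$ on $\overline{\mathcal{O}}$ for all $1\le i\le N$ (the Laplacian acting componentwise). (iv) $\langle\langle\nabla b_i,\nu\rangle,b_i\rangle+\langle\langle\nabla b_i,b_i\rangle,\nu\rangle=0$ on $\partial\mathcal{O}$ for all $1\le i\le N$ (the gradient acting componentwise, i.e. $\langle\nabla b_i,v\rangle$ is the vector with $j$-th component $\langle\nabla b_i^j,v\rangle$). *)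

theory Defs
  imports "HOL-Analysis.Analysis"
begin

definition has_pd :: "'d \<Rightarrow> (real ^ 'd::finite \<Rightarrow> real) \<Rightarrow> real ^ 'd \<Rightarrow> bool" where
  "has_pd j f x \<longleftrightarrow> (\<lambda>t::real. f (x + t *\<^sub>R axis j 1)) field_differentiable (at 0)"

(* The j-th partial derivative of f on the closure of the open set \<Omega>: the classical partial
   derivative inside \<Omega>, and its limit from within \<Omega> at the boundary. The value off closure \<Omega>
   carries no meaning. *)
definition pd :: "(real ^ 'd::finite) set \<Rightarrow> 'd \<Rightarrow> (real ^ 'd \<Rightarrow> real) \<Rightarrow> real ^ 'd \<Rightarrow> real" where
  "pd \<Omega> j f x =
     (let D = (\<lambda>y. deriv (\<lambda>t::real. f (y + t *\<^sub>R axis j 1)) 0)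
      in if x \<in> \<Omega> then D x else Lim (at x within \<Omega>) D)"

(* f \<in> C^k(closure \<Omega>): all partial derivatives of order \<le> k exist in \<Omega> and they (and f itself)
   extend continuously to closure \<Omega>. Since pd already takes the boundary limits, continuity of
   the iterated pd on closure \<Omega> is exactly the existence of these extensions. *)
primrec Ck_closure :: "nat \<Rightarrow> (real ^ 'd::finite) set \<Rightarrow> (real ^ 'd \<Rightarrow> real) \<Rightarrow> bool" where
  "Ck_closure 0 \<Omega> f \<longleftrightarrow> continuous_on (closure \<Omega>) f"
| "Ck_closure (Suc k) \<Omega> f \<longleftrightarrow> continuous_on (closure \<Omega>) f \<and>
     (\<forall>j. (\<forall>x\<in>\<Omega>. has_pd j f x) \<and> Ck_closure k \<Omega> (pd \<Omega> j f))"

definition vec_Ck_closure ::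
    "nat \<Rightarrow> (real ^ 'd::finite) set \<Rightarrow> (real ^ 'd \<Rightarrow> real ^ 'd) \<Rightarrow> bool" where
  "vec_Ck_closure k \<Omega> F \<longleftrightarrow> (\<forall>j. Ck_closure k \<Omega> (\<lambda>x. F x $ j))"

(* On the whole space there is no boundary, so this is the usual C^infinity. *)
definition smooth :: "(real ^ 'd::finite \<Rightarrow> real) \<Rightarrow> bool" where
  "smooth f \<longleftrightarrow> (\<forall>k. Ck_closure k UNIV f)"

definition grad :: "(real ^ 'd::finite) set \<Rightarrow> (real ^ 'd \<Rightarrow> real) \<Rightarrow> real ^ 'd \<Rightarrow> real ^ 'd" where
  "grad \<Omega> f x = (\<chi> j. pd \<Omega> j f x)"

(* The vector \<langle>\<nabla>F(x), v\<rangle>, whose j-th component is \<langle>\<nabla>F^j(x), v\<rangle>. *)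
definition grad_inner ::
    "(real ^ 'd::finite) set \<Rightarrow> (real ^ 'd \<Rightarrow> real ^ 'd) \<Rightarrow> real ^ 'd \<Rightarrow> real ^ 'd \<Rightarrow> real ^ 'd" where
  "grad_inner \<Omega> F x v = (\<chi> j. grad \<Omega> (\<lambda>y. F y $ j) x \<bullet> v)"

definition divergence ::
    "(real ^ 'd::finite) set \<Rightarrow> (real ^ 'd \<Rightarrow> real ^ 'd) \<Rightarrow> real ^ 'd \<Rightarrow> real" where
  "divergence \<Omega> F x = (\<Sum>j\<in>UNIV. pd \<Omega> j (\<lambda>y. F y $ j) x)"

definition laplacian :: "(real ^ 'd::finite) set \<Rightarrow> (real ^ 'd \<Rightarrow> real) \<Rightarrow> real ^ 'd \<Rightarrow> real" where
  "laplacian \<Omega> f x = (\<Sum>k\<in>UNIV. pd \<Omega> k (pd \<Omega> k f) x)"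

definition vec_laplacian ::
    "(real ^ 'd::finite) set \<Rightarrow> (real ^ 'd \<Rightarrow> real ^ 'd) \<Rightarrow> real ^ 'd \<Rightarrow> real ^ 'd" where
  "vec_laplacian \<Omega> F x = (\<chi> j. laplacian \<Omega> (\<lambda>y. F y $ j) x)"

(* Near each boundary point, \<Omega> is one side of the graph of a smooth function of the d - 1
   coordinates other than the k-th; the sign s records on which side of the graph \<Omega> lies. *)
definition smooth_boundary :: "(real ^ 'd::finite) set \<Rightarrow> bool" where
  "smooth_boundary \<Omega> \<longleftrightarrow>
     (\<forall>x\<in>frontier \<Omega>. \<exists>r>0. \<exists>k. \<exists>s\<in>{-1, 1}. \<exists>\<gamma>. smooth \<gamma> \<and>
        (\<forall>y t. \<gamma> (y + t *\<^sub>R axis k 1) = \<gamma> y) \<and>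
        \<Omega> \<inter> ball x r = {y \<in> ball x r. s * y $ k > \<gamma> y})"

(* Velocities at x of curves running in S; for S the boundary of a smooth domain, the tangent
   space of S at x. *)
definition tangent_vectors :: "(real ^ 'd::finite) set \<Rightarrow> real ^ 'd \<Rightarrow> (real ^ 'd) set" where
  "tangent_vectors S x =
     {v. \<exists>c. \<exists>\<delta>>0. c 0 = x \<and> (\<forall>t\<in>{-\<delta><..<\<delta>}. c t \<in> S) \<and> (c has_vector_derivative v) (at (0::real))}"

definition outer_unit_normal_at :: "(real ^ 'd::finite) set \<Rightarrow> real ^ 'd \<Rightarrow> real ^ 'd \<Rightarrow> bool" where
  "outer_unit_normal_at \<Omega> x n \<longleftrightarrow>
     norm n = 1 \<and>
     (\<forall>v\<in>tangent_vectors (frontier \<Omega>) x. v \<bullet> n = 0) \<and>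
     (\<exists>\<epsilon>>0. \<forall>t\<in>{0<..<\<epsilon>}. x + t *\<^sub>R n \<notin> closure \<Omega>)"

end

theory Submission
  imports Defs
begin

text \<open>
  The conditions on a field \<open>b\<close> force its Jacobian to be antisymmetric (\<open>b\<close> is a Killing field), and the
  claim is a pointwise consequence of that.

  Rigidity. Let \<open>J\<close> be the Jacobian of \<open>b\<close> and \<open>S = J + J\<^sup>T\<close>. Symmetry of second derivatives and
  \<open>div b = 0\<close> give \<open>div S = \<Delta>b\<close> row by row, hence \<open>div (S b) = \<langle>\<Delta>b, b\<rangle> + |S|\<^sup>2/2 = |S|\<^sup>2/2\<close>. On the
  boundary \<open>\<langle>S b, \<nu>\<rangle>\<close> is exactly the left-hand side of \<open>cond_iv\<close>, hence zero, so the divergence theorem yields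
  \<open>\<integral>|S|\<^sup>2 = 0\<close>, that is \<open>S = 0\<close> on the closure (\<open>sym_jacobian_eq_0\<close>). On its own \<open>cond_iv\<close>
  controls \<open>S \<nu>\<close> only in the direction of \<open>b\<close>; integrating is what gives all directions.

  Conclusion. Let \<open>n\<close> be the gradient of a defining function of the boundary; it is parallel to \<open>\<nu>\<close>, and its
  derivative \<open>M\<close> is symmetric, being a Hessian. Both \<open>b\<close> and \<open>\<nabla>u\<close> are tangential. Differentiating
  \<open>\<langle>\<nabla>u, n\<rangle> = 0\<close> along \<open>b\<close> and \<open>\<langle>b, n\<rangle> = 0\<close> along \<open>\<nabla>u\<close> (\<open>tangential_derivative_eq_0\<close>)
  produces the same curvature term \<open>\<langle>M b, \<nabla>u\<rangle>\<close>, so \<open>\<langle>D\<^sup>2u b, n\<rangle> = \<langle>J \<nabla>u, n\<rangle>\<close>. Therefore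
  \<open>\<langle>\<nabla>\<langle>b, \<nabla>u\<rangle>, n\<rangle> = \<langle>J n, \<nabla>u\<rangle> + \<langle>D\<^sup>2u n, b\<rangle> = \<langle>\<nabla>u, S n\<rangle> = 0\<close>.

  The divergence theorem is needed only for fields with vanishing normal component, which makes a proof
  without surface integrals possible (\<open>integral_divergence_tangential_eq_0\<close>): near the boundary such a field \<open>V\<close> is
  multiplied by the cutoff \<open>\<rho>\<^sup>2/(\<epsilon>\<^sup>2 + \<rho>\<^sup>2)\<close>, where \<open>\<rho>\<close> is the defining function. The product, extended by
  zero, is differentiable on the whole space, where integrals of derivatives vanish by translation
  invariance of Lebesgue measure. Since \<open>|\<langle>V, \<nabla>\<rho>\<rangle>| \<le> C \<rho>\<close>, the error term with the gradient of the cutoff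
  is bounded uniformly in \<open>\<epsilon>\<close> and disappears in the limit by dominated convergence. Finitely many
  such local statements are glued by a partition of unity.
\<close>

section \<open>Continuous partial derivatives and Schwarz's theorem\<close>

lemma pd_has_real_derivative:
  fixes f :: "real ^ 'd::finite \<Rightarrow> real"
  assumes "y + t *\<^sub>R axis j 1 \<in> \<Omega>" and "has_pd j f (y + t *\<^sub>R axis j 1)"
  shows "((\<lambda>t. f (y + t *\<^sub>R axis j 1)) has_real_derivative pd \<Omega> j f (y + t *\<^sub>R axis j 1)) (at t)"
proof -
  have "((\<lambda>h. f ((y + t *\<^sub>R axis j 1) + h *\<^sub>R axis j 1)) has_real_derivative
      pd \<Omega> j f (y + t *\<^sub>R axis j 1)) (at 0)"
    using assms by (simp add: pd_def has_pd_def DERIV_deriv_iff_field_differentiable)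
  then have "((\<lambda>h. f (y + (h + t) *\<^sub>R axis j 1)) has_real_derivative
      pd \<Omega> j f (y + t *\<^sub>R axis j 1)) (at 0)"
    by (simp add: algebra_simps)
  then show ?thesis
    using DERIV_shift[of "\<lambda>t. f (y + t *\<^sub>R axis j 1)" _ 0 t] by simp
qed

lemma pd_eq_derivative:
  assumes "x \<in> \<Omega>" and "(f has_derivative D) (at x)"
  shows "pd \<Omega> j f x = D (axis j 1)"
proof -
  have "((\<lambda>t. x + t *\<^sub>R axis j 1) has_derivative (\<lambda>t. t *\<^sub>R axis j 1)) (at (0::real))"
    by (auto intro!: derivative_eq_intros)
  moreover have "(f has_derivative D) (at (x + 0 *\<^sub>R axis j 1))"
    using assms by simp
  ultimately have "((\<lambda>t. f (x + t *\<^sub>R axis j 1)) has_derivative (\<lambda>t. D (t *\<^sub>R axis j 1))) (at (0::real))"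
    by (rule has_derivative_compose)
  moreover have "(\<lambda>t. D (t *\<^sub>R axis j 1)) = (*) (D (axis j 1))"
    using assms(2) by (auto simp: linear_scale has_derivative_linear)
  ultimately have "((\<lambda>t. f (x + t *\<^sub>R axis j 1)) has_real_derivative D (axis j 1)) (at 0)"
    by (simp add: has_field_derivative_def)
  then show ?thesis
    using assms(1) by (simp add: pd_def DERIV_imp_deriv)
qed

text \<open>
  The increment is split into steps along single coordinate axes; the mean value inequality is applied
  to each step. The induction runs over the set of coordinates in which \<open>v\<close> may be nonzero, so that the
  dimension can stay a type.
\<close>
lemma increment_le_of_pd_close:
  fixes f :: "real ^ 'd::finite \<Rightarrow> real"
  assumes sub: "ball x r \<subseteq> \<Omega>" and pd: "\<And>j y. y \<in> ball x r \<Longrightarrow> has_pd j f y"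
    and close: "\<And>j y. y \<in> ball x r \<Longrightarrow> \<bar>pd \<Omega> j f y - pd \<Omega> j f x\<bar> \<le> \<epsilon>"
    and "finite A"
  shows "(\<forall>i. i \<notin> A \<longrightarrow> v $ i = 0) \<Longrightarrow> norm v < r \<Longrightarrow>
    \<bar>f (x + v) - f x - (\<Sum>j\<in>A. pd \<Omega> j f x * v $ j)\<bar> \<le> \<epsilon> * (\<Sum>j\<in>A. \<bar>v $ j\<bar>)"
  using \<open>finite A\<close>
proof (induction A arbitrary: v)
  case empty
  then have "v = 0" by (simp add: vec_eq_iff)
  then show ?case by simp
next
  case (insert a A)
  define w where "w = (\<chi> i. if i = a then 0 else v $ i)"
  have v: "v = w + (v $ a) *\<^sub>R axis a 1"
    by (simp add: w_def vec_eq_iff axis_def)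
  have nw: "norm (w + t *\<^sub>R axis a 1) < r" if "\<bar>t\<bar> \<le> \<bar>v $ a\<bar>" for t
  proof -
    have "norm (w + t *\<^sub>R axis a 1) \<le> norm v"
      by (rule norm_le_componentwise_cart) (use that in \<open>auto simp: w_def axis_def\<close>)
    then show ?thesis using insert.prems by simp
  qed
  have "\<bar>f (x + w) - f x - (\<Sum>j\<in>A. pd \<Omega> j f x * w $ j)\<bar> \<le> \<epsilon> * (\<Sum>j\<in>A. \<bar>w $ j\<bar>)"
    using insert.prems nw[of 0] by (intro insert.IH) (auto simp: w_def)
  moreover have "(\<Sum>j\<in>A. pd \<Omega> j f x * w $ j) = (\<Sum>j\<in>A. pd \<Omega> j f x * v $ j)"
    "(\<Sum>j\<in>A. \<bar>w $ j\<bar>) = (\<Sum>j\<in>A. \<bar>v $ j\<bar>)"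
    using insert.hyps by (auto intro!: sum.cong simp: w_def)
  moreover have "\<bar>f (x + v) - f (x + w) - pd \<Omega> a f x * v $ a\<bar> \<le> \<epsilon> * \<bar>v $ a\<bar>"
  proof -
    define g where "g t = f ((x + w) + t *\<^sub>R axis a 1) - pd \<Omega> a f x * t" for t
    define g' where "g' t = pd \<Omega> a f ((x + w) + t *\<^sub>R axis a 1) - pd \<Omega> a f x" for t
    define T where "T = {t. \<bar>t\<bar> \<le> \<bar>v $ a\<bar>}"
    have T: "T = cball 0 \<bar>v $ a\<bar>" by (auto simp: T_def dist_norm)
    have inb: "(x + w) + t *\<^sub>R axis a 1 \<in> ball x r" if "t \<in> T" for t
    proof -
      have "x - (x + w + t *\<^sub>R axis a 1) = - (w + t *\<^sub>R axis a 1)" by simp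
      then show ?thesis
        using nw[of t] that unfolding T_def mem_ball dist_norm by (metis mem_Collect_eq norm_minus_cancel)
    qed
    have "(g has_real_derivative g' t) (at t within T)" if "t \<in> T" for t
      unfolding g_def g'_def
      by (rule DERIV_subset[where s=UNIV])
        (use pd_has_real_derivative[of "x+w" t a \<Omega> f] inb[OF that] sub pd in \<open>auto intro!: derivative_eq_intros\<close>)
    then have "norm (g (v $ a) - g 0) \<le> \<epsilon> * norm (v $ a - 0)"
      by (rule field_differentiable_bound[rotated])
        (use inb close in \<open>auto simp: T g'_def simp del: mem_ball\<close>)
    then show ?thesis
      by (subst v) (simp add: g_def algebra_simps)
  qed
  ultimately show ?case
    using insert.hyps by (simp add: algebra_simps)
qed

text \<open>
  Continuous partial derivatives make a function differentiable: near \<open>x\<close> they vary by at most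
  \<open>\<epsilon>\<close>, and the coordinatewise increments then add up to the linear approximation.
\<close>
lemma has_derivative_grad:
  fixes f :: "real ^ 'd::finite \<Rightarrow> real"
  assumes "open \<Omega>" and pd: "\<And>j y. y \<in> \<Omega> \<Longrightarrow> has_pd j f y"
    and cont: "\<And>j. continuous_on \<Omega> (pd \<Omega> j f)" and x: "x \<in> \<Omega>"
  shows "(f has_derivative (\<lambda>v. grad \<Omega> f x \<bullet> v)) (at x)"
  unfolding has_derivative_at_alt
proof (intro conjI allI impI)
  show "bounded_linear (\<lambda>v. grad \<Omega> f x \<bullet> v)" by (rule bounded_linear_inner_right)
  fix e :: real assume "e > 0"
  define \<epsilon> where "\<epsilon> = e / real CARD('d)"
  have "\<epsilon> > 0" using \<open>e > 0\<close> by (simp add: \<epsilon>_def)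
  have "\<forall>\<^sub>F y in nhds x. \<forall>j. \<bar>pd \<Omega> j f y - pd \<Omega> j f x\<bar> \<le> \<epsilon>"
  proof (rule eventually_all_finite)
    fix j
    have "isCont (pd \<Omega> j f) x"
      using cont x \<open>open \<Omega>\<close> by (simp add: continuous_on_eq_continuous_at)
    then have "\<forall>\<^sub>F y in nhds x. dist (pd \<Omega> j f y) (pd \<Omega> j f x) < \<epsilon>"
      using \<open>\<epsilon> > 0\<close> by (metis continuous_at tendsto_at_iff_tendsto_nhds tendstoD isCont_def)
    then show "\<forall>\<^sub>F y in nhds x. \<bar>pd \<Omega> j f y - pd \<Omega> j f x\<bar> \<le> \<epsilon>"
      by eventually_elim (simp add: dist_real_def)
  qed
  moreover have "\<forall>\<^sub>F y in nhds x. y \<in> \<Omega>"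
    using x \<open>open \<Omega>\<close> by (rule eventually_nhds_in_open[rotated])
  ultimately have "\<forall>\<^sub>F y in nhds x. y \<in> \<Omega> \<and> (\<forall>j. \<bar>pd \<Omega> j f y - pd \<Omega> j f x\<bar> \<le> \<epsilon>)"
    by eventually_elim simp
  then obtain r where "r > 0" and r: "\<And>y. dist y x < r \<Longrightarrow> y \<in> \<Omega> \<and> (\<forall>j. \<bar>pd \<Omega> j f y - pd \<Omega> j f x\<bar> \<le> \<epsilon>)"
    unfolding eventually_nhds_metric by blast
  show "\<exists>d>0. \<forall>y. norm (y - x) < d \<longrightarrow> norm (f y - f x - grad \<Omega> f x \<bullet> (y - x)) \<le> e * norm (y - x)"
  proof (intro exI conjI allI impI)
    fix y assume y: "norm (y - x) < r"
    have "\<bar>f (x + (y - x)) - f x - (\<Sum>j\<in>UNIV. pd \<Omega> j f x * (y - x) $ j)\<bar> \<le> \<epsilon> * (\<Sum>j\<in>UNIV. \<bar>(y - x) $ j\<bar>)"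
      by (rule increment_le_of_pd_close[where r=r]) (use y r pd in \<open>auto simp: dist_commute\<close>)
    also have "\<dots> \<le> \<epsilon> * (\<Sum>j\<in>(UNIV::'d set). norm (y - x))"
      using \<open>\<epsilon> > 0\<close> by (intro mult_left_mono sum_mono component_le_norm_cart) auto
    finally show "norm (f y - f x - grad \<Omega> f x \<bullet> (y - x)) \<le> e * norm (y - x)"
      by (simp add: grad_def inner_vec_def \<epsilon>_def)
  qed (rule \<open>r > 0\<close>)
qed

text \<open>
  Two applications of the mean value theorem, first along the \<open>j\<close>-th and then along the \<open>k\<close>-th axis. The left-hand
  side is symmetric in \<open>j\<close> and \<open>k\<close>, which is what makes the mixed derivatives commute.
\<close>
lemma second_difference_eq_mixed_pd:
  fixes f :: "real ^ 'd::finite \<Rightarrow> real"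
  assumes sub: "ball x r \<subseteq> \<Omega>"
    and pd: "\<And>y. y \<in> \<Omega> \<Longrightarrow> has_pd j f y"
    and pd2: "\<And>y. y \<in> \<Omega> \<Longrightarrow> has_pd k (pd \<Omega> j f) y"
    and s: "0 < s" "2 * s < r"
  obtains y where "y \<in> ball x r" and
    "f (x + s *\<^sub>R axis j 1 + s *\<^sub>R axis k 1) - f (x + s *\<^sub>R axis j 1) - f (x + s *\<^sub>R axis k 1) + f x
      = s * s * pd \<Omega> k (pd \<Omega> j f) y"
proof -
  have inb: "x + a *\<^sub>R axis j 1 + b *\<^sub>R axis k 1 \<in> ball x r" if "0 \<le> a" "a \<le> s" "0 \<le> b" "b \<le> s" for a b
  proof -
    have "norm (a *\<^sub>R axis j 1 + b *\<^sub>R axis k (1::real)) \<le> a + b"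
      using norm_triangle_ineq[of "a *\<^sub>R axis j 1" "b *\<^sub>R axis k (1::real)"] that by simp
    also have "\<dots> < r" using that s by simp
    finally have "norm (a *\<^sub>R axis j 1 + b *\<^sub>R axis k (1::real)) < r" .
    moreover have "x - (x + a *\<^sub>R axis j 1 + b *\<^sub>R axis k 1) = - (a *\<^sub>R axis j 1 + b *\<^sub>R axis k (1::real))"
      by simp
    ultimately show ?thesis unfolding mem_ball dist_norm by (metis norm_minus_cancel)
  qed
  define g where "g a = f ((x + s *\<^sub>R axis k 1) + a *\<^sub>R axis j 1) - f (x + a *\<^sub>R axis j 1)" for a
  have "\<exists>a>0. a < s \<and> g s - g 0 = (s - 0) * (pd \<Omega> j f ((x + s *\<^sub>R axis k 1) + a *\<^sub>R axis j 1) - pd \<Omega> j f (x + a *\<^sub>R axis j 1))"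
  proof (rule MVT2)
    fix a assume a: "0 \<le> a" "a \<le> s"
    show "(g has_real_derivative (pd \<Omega> j f ((x + s *\<^sub>R axis k 1) + a *\<^sub>R axis j 1) - pd \<Omega> j f (x + a *\<^sub>R axis j 1))) (at a)"
      unfolding g_def
      by (intro DERIV_diff pd_has_real_derivative pd subsetD[OF sub])
        (use inb[of a s] inb[of a 0] a s in \<open>auto simp: add_ac simp del: mem_ball\<close>)
  qed (use s in auto)
  then obtain a where a: "0 < a" "a < s" and ga: "g s - g 0 = s * (pd \<Omega> j f ((x + s *\<^sub>R axis k 1) + a *\<^sub>R axis j 1) - pd \<Omega> j f (x + a *\<^sub>R axis j 1))"
    by auto
  define h where "h b = pd \<Omega> j f ((x + a *\<^sub>R axis j 1) + b *\<^sub>R axis k 1)" for b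
  have "\<exists>b>0. b < s \<and> h s - h 0 = (s - 0) * pd \<Omega> k (pd \<Omega> j f) ((x + a *\<^sub>R axis j 1) + b *\<^sub>R axis k 1)"
  proof (rule MVT2)
    fix b assume b: "0 \<le> b" "b \<le> s"
    show "(h has_real_derivative pd \<Omega> k (pd \<Omega> j f) ((x + a *\<^sub>R axis j 1) + b *\<^sub>R axis k 1)) (at b)"
      unfolding h_def
      by (intro pd_has_real_derivative pd2 subsetD[OF sub] inb) (use a b in auto)
  qed (use s in auto)
  then obtain b where b: "0 < b" "b < s" and hb: "h s - h 0 = s * pd \<Omega> k (pd \<Omega> j f) ((x + a *\<^sub>R axis j 1) + b *\<^sub>R axis k 1)"
    by auto
  show thesis
  proof (rule that)
    show "(x + a *\<^sub>R axis j 1) + b *\<^sub>R axis k 1 \<in> ball x r"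
      using a b by (intro inb) auto
    have "f (x + s *\<^sub>R axis j 1 + s *\<^sub>R axis k 1) - f (x + s *\<^sub>R axis j 1) - f (x + s *\<^sub>R axis k 1) + f x = g s - g 0"
      by (simp add: g_def add_ac)
    also have "\<dots> = s * (h s - h 0)" unfolding ga by (simp add: h_def add_ac)
    finally show "f (x + s *\<^sub>R axis j 1 + s *\<^sub>R axis k 1) - f (x + s *\<^sub>R axis j 1) - f (x + s *\<^sub>R axis k 1) + f x
      = s * s * pd \<Omega> k (pd \<Omega> j f) ((x + a *\<^sub>R axis j 1) + b *\<^sub>R axis k 1)"
      unfolding hb by simp
  qed
qed

text \<open>
  Schwarz's theorem: both mixed derivatives are limits of the same second difference quotient.
\<close>
lemma pd_commute:
  fixes f :: "real ^ 'd::finite \<Rightarrow> real"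
  assumes "open \<Omega>" and x: "x \<in> \<Omega>"
    and pd: "\<And>i y. y \<in> \<Omega> \<Longrightarrow> has_pd i f y"
    and pd2: "\<And>i l y. y \<in> \<Omega> \<Longrightarrow> has_pd i (pd \<Omega> l f) y"
    and cont: "\<And>i l. continuous_on \<Omega> (pd \<Omega> i (pd \<Omega> l f))"
  shows "pd \<Omega> j (pd \<Omega> k f) x = pd \<Omega> k (pd \<Omega> j f) x"
proof (rule dist_eq_0_iff[THEN iffD1], rule antisym, rule field_le_epsilon)
  fix e :: real assume "e > 0"
  define P Q where "P = pd \<Omega> j (pd \<Omega> k f)" and "Q = pd \<Omega> k (pd \<Omega> j f)"
  have "isCont P x" "isCont Q x"
    using cont x \<open>open \<Omega>\<close> by (auto simp: continuous_on_eq_continuous_at P_def Q_def)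
  then obtain p q where "p > 0" and p: "\<And>y. dist x y < p \<Longrightarrow> dist (P x) (P y) < e/2"
    and "q > 0" and q: "\<And>y. dist x y < q \<Longrightarrow> dist (Q x) (Q y) < e/2"
    using \<open>e > 0\<close> unfolding continuous_at_eps_delta by (metis dist_commute half_gt_zero)
  obtain r0 where "r0 > 0" and r0: "ball x r0 \<subseteq> \<Omega>"
    using \<open>open \<Omega>\<close> x by (meson openE)
  define r where "r = min r0 (min p q)"
  have "r > 0" and sub: "ball x r \<subseteq> \<Omega>"
    using r0 \<open>p > 0\<close> \<open>q > 0\<close> \<open>r0 > 0\<close> by (auto simp: r_def)
  \<comment> \<open>2 s < r keeps the square spanned by s times the two axis vectors inside the ball\<close>
  define s where "s = r / 3"
  have s: "0 < s" "2 * s < r" using \<open>r > 0\<close> by (auto simp: s_def)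
  obtain y where y: "y \<in> ball x r" and
    yeq: "f (x + s *\<^sub>R axis j 1 + s *\<^sub>R axis k 1) - f (x + s *\<^sub>R axis j 1) - f (x + s *\<^sub>R axis k 1) + f x
      = s * s * Q y"
    using second_difference_eq_mixed_pd[OF sub pd pd2 s] unfolding Q_def by metis
  obtain z where z: "z \<in> ball x r" and
    zeq: "f (x + s *\<^sub>R axis k 1 + s *\<^sub>R axis j 1) - f (x + s *\<^sub>R axis k 1) - f (x + s *\<^sub>R axis j 1) + f x
      = s * s * P z"
    using second_difference_eq_mixed_pd[OF sub pd pd2 s] unfolding P_def by metis
  have "s * s * Q y = s * s * P z"
    unfolding yeq[symmetric] zeq[symmetric] by (simp add: add_ac)
  then have "Q y = P z" using s by simp
  moreover have "dist (Q x) (Q y) < e/2" "dist (P x) (P z) < e/2"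
    using y z p q by (auto simp: r_def)
  ultimately show "dist (P x) (Q x) \<le> 0 + e"
    by (auto simp: dist_real_def abs_if split: if_splits)
qed auto

section \<open>Fields that are continuously differentiable up to the boundary\<close>

text \<open>
  The matrix field \<open>A\<close> is the Jacobian of \<open>V\<close> inside \<open>\<Omega>\<close>; on the boundary, where \<open>V\<close> need not be differentiable,
  it is the continuous extension.
\<close>
definition C1_closure_field ::
    "(real ^ 'd::finite) set \<Rightarrow> (real ^ 'd \<Rightarrow> real ^ 'd) \<Rightarrow> (real ^ 'd \<Rightarrow> real ^ 'd ^ 'd) \<Rightarrow> bool" where
  "C1_closure_field \<Omega> V A \<longleftrightarrow> continuous_on (closure \<Omega>) V \<and> continuous_on (closure \<Omega>) A \<and>
     (\<forall>y\<in>\<Omega>. (V has_derivative (\<lambda>v. A y *v v)) (at y))"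

definition jacobian :: "(real ^ 'd::finite) set \<Rightarrow> (real ^ 'd \<Rightarrow> real ^ 'd) \<Rightarrow> real ^ 'd \<Rightarrow> real ^ 'd ^ 'd" where
  "jacobian \<Omega> V y = (\<chi> i j. pd \<Omega> j (\<lambda>z. V z $ i) y)"

lemma has_derivative_vecI:
  fixes f :: "'a::real_normed_vector \<Rightarrow> real ^ 'n::finite"
  assumes "\<And>i. ((\<lambda>x. f x $ i) has_derivative (\<lambda>v. f' v $ i)) F"
  shows "(f has_derivative f') F"
proof -
  have "bounded_linear (\<lambda>v. f' v $ i)" for i using assms has_derivative_bounded_linear by blast
  then have "\<forall>i\<in>Basis. ((\<lambda>x. f x \<bullet> i) has_derivative (\<lambda>x. f' x \<bullet> i)) F"
    using assms by (auto simp: Basis_vec_def inner_axis)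
  then show ?thesis
    unfolding has_derivative_def
  proof (intro conjI)
    assume *: "\<forall>i\<in>Basis. bounded_linear (\<lambda>x. f' x \<bullet> i) \<and>
      ((\<lambda>y. ((f y \<bullet> i - f (Lim F (\<lambda>x. x)) \<bullet> i) - f' (y - Lim F (\<lambda>x. x)) \<bullet> i) /\<^sub>R norm (y - Lim F (\<lambda>x. x))) \<longlongrightarrow> 0) F"
    show "bounded_linear f'" using * by (subst bounded_linear_componentwise_iff) auto
    show "((\<lambda>y. ((f y - f (Lim F (\<lambda>x. x))) - f' (y - Lim F (\<lambda>x. x))) /\<^sub>R norm (y - Lim F (\<lambda>x. x))) \<longlongrightarrow> 0) F"
      using * by (subst tendsto_componentwise_iff) (auto simp: inner_diff_left)
  qed
qed

lemma Ck_closure_has_derivative: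
  assumes "open \<Omega>" "Ck_closure (Suc k) \<Omega> f" "y \<in> \<Omega>"
  shows "(f has_derivative (\<lambda>v. grad \<Omega> f y \<bullet> v)) (at y)"
proof (rule has_derivative_grad[OF assms(1) _ _ assms(3)])
  show "has_pd j f z" if "z \<in> \<Omega>" for j z using assms(2) that by simp
  show "continuous_on \<Omega> (pd \<Omega> j f)" for j
    using assms(2) by (cases k) (auto intro: continuous_on_subset[OF _ closure_subset])
qed

lemma Ck_closure_continuous: "Ck_closure k \<Omega> f \<Longrightarrow> continuous_on (closure \<Omega>) f"
  by (cases k) auto

lemma vec_Ck_closure_grad: "Ck_closure (Suc k) \<Omega> f \<Longrightarrow> vec_Ck_closure k \<Omega> (grad \<Omega> f)"
  by (simp add: vec_Ck_closure_def grad_def)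

lemma C1_closure_field_jacobian:
  assumes "open \<Omega>" "vec_Ck_closure (Suc k) \<Omega> V"
  shows "C1_closure_field \<Omega> V (jacobian \<Omega> V)"
  unfolding C1_closure_field_def
proof (intro conjI ballI)
  have *: "Ck_closure (Suc k) \<Omega> (\<lambda>x. V x $ i)" for i using assms(2) by (simp add: vec_Ck_closure_def)
  have "continuous_on (closure \<Omega>) (\<lambda>x. \<chi> i. V x $ i)"
    using * by (intro continuous_on_vec_lambda) (auto intro: Ck_closure_continuous)
  then show "continuous_on (closure \<Omega>) V" by simp
  show "continuous_on (closure \<Omega>) (jacobian \<Omega> V)"
    unfolding jacobian_def[abs_def]
    using * by (intro continuous_on_vec_lambda) (auto intro: Ck_closure_continuous)
  fix y assume "y \<in> \<Omega>"
  show "(V has_derivative (\<lambda>v. jacobian \<Omega> V y *v v)) (at y)"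
  proof (rule has_derivative_vecI)
    fix i
    show "((\<lambda>x. V x $ i) has_derivative (\<lambda>v. (jacobian \<Omega> V y *v v) $ i)) (at y)"
      using Ck_closure_has_derivative[OF assms(1) * \<open>y \<in> \<Omega>\<close>, of i]
      by (simp add: jacobian_def matrix_vector_mult_def grad_def inner_vec_def)
  qed
qed

text \<open>
  On the boundary the iterated \<open>pd\<close> are limits from inside, so the symmetry persists there.
\<close>
lemma Ck_closure_pd_commute:
  assumes "open \<Omega>" "Ck_closure (Suc (Suc k)) \<Omega> f" "x \<in> closure \<Omega>"
  shows "pd \<Omega> i (pd \<Omega> j f) x = pd \<Omega> j (pd \<Omega> i f) x"
proof (rule continuous_constant_on_closure[where a=0 and f="\<lambda>x. pd \<Omega> i (pd \<Omega> j f) x - pd \<Omega> j (pd \<Omega> i f) x", THEN eq_iff_diff_eq_0[THEN iffD2]])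
  have c: "continuous_on (closure \<Omega>) (pd \<Omega> i (pd \<Omega> j f))" for i j
    by (rule Ck_closure_continuous[of k]) (use assms(2) in simp)
  then show "continuous_on (closure \<Omega>) (\<lambda>x. pd \<Omega> i (pd \<Omega> j f) x - pd \<Omega> j (pd \<Omega> i f) x)"
    by (intro continuous_intros)
  show "pd \<Omega> i (pd \<Omega> j f) y - pd \<Omega> j (pd \<Omega> i f) y = 0" if "y \<in> \<Omega>" for y
  proof -
    have "pd \<Omega> i (pd \<Omega> j f) y = pd \<Omega> j (pd \<Omega> i f) y"
    proof (rule pd_commute[OF assms(1) that])
      show "continuous_on \<Omega> (pd \<Omega> i (pd \<Omega> l f))" for i l
        using c continuous_on_subset closure_subset by blast
    qed (use assms(2) in auto)
    then show ?thesis by simp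
  qed
qed (rule assms(3))

lemma jacobian_grad_symmetric:
  assumes "open \<Omega>" "Ck_closure (Suc (Suc k)) \<Omega> f" "x \<in> closure \<Omega>"
  shows "transpose (jacobian \<Omega> (grad \<Omega> f) x) = jacobian \<Omega> (grad \<Omega> f) x"
  using Ck_closure_pd_commute[OF assms] by (simp add: jacobian_def grad_def transpose_def vec_eq_iff)

section \<open>Integrals of derivatives over the whole space\<close>

text \<open>
  The difference quotients \<open>(f (y + h) - f y) / t\<close> with \<open>h = t e\<close> have integral zero because Lebesgue measure is invariant
  under translations. They converge to the directional derivative and are dominated by the Lipschitz bound on
  a fixed ball.
\<close>
lemma integral_directional_derivative_eq_0:
  fixes f :: "'a::euclidean_space \<Rightarrow> real"
  assumes "bounded S" and zero: "\<And>y. y \<notin> S \<Longrightarrow> f y = 0"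
    and deriv: "\<And>y. (f has_derivative f' y) (at y)"
    and bound: "\<And>y v. \<bar>f' y v\<bar> \<le> C * norm v"
  shows "has_bochner_integral lborel (\<lambda>y. f' y e) 0"
proof -
  obtain R where R: "\<And>y. y \<in> S \<Longrightarrow> norm y \<le> R" using \<open>bounded S\<close> unfolding bounded_iff by blast
  have cont: "continuous_on UNIV f"
    using has_derivative_continuous[OF deriv] by (simp add: continuous_on_eq_continuous_at)
  have meas: "f \<in> borel_measurable borel" by (rule borel_measurable_continuous_onI[OF cont])
  have "integrable lborel (\<lambda>y. indicator (cball 0 R) y *\<^sub>R f y)"
    by (intro borel_integrable_compact continuous_on_subset[OF cont]) auto
  moreover have "(\<lambda>y. indicator (cball 0 R) y *\<^sub>R f y) = f"
    using R zero by (force simp: indicator_def)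
  ultimately have int: "integrable lborel f" by simp
  have trans: "has_bochner_integral lborel (\<lambda>y. f (h + y)) (integral\<^sup>L lborel f)" for h
  proof -
    have h: "(+) h \<in> measurable lborel borel" by simp
    have "integrable lborel (\<lambda>y. f (h + y))"
      using integrable_distr_eq[OF h meas] int unfolding lborel_distr_plus by simp
    moreover have "(\<integral>y. f (h + y) \<partial>lborel) = integral\<^sup>L lborel f"
      using integral_distr[OF h meas, symmetric] unfolding lborel_distr_plus .
    ultimately show ?thesis unfolding has_bochner_integral_iff ..
  qed
  define g where "g m y = real (Suc m) * (f ((1 / real (Suc m)) *\<^sub>R e + y) - f y)" for m y
  have g0: "has_bochner_integral lborel (g m) 0" for m
  proof -
    have "has_bochner_integral lborel (g m) (real (Suc m) * (integral\<^sup>L lborel f - integral\<^sup>L lborel f))"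
      unfolding g_def using trans int
      by (intro has_bochner_integral_mult_right has_bochner_integral_diff has_bochner_integral_integrable) auto
    then show ?thesis by simp
  qed
  have C: "0 \<le> C * norm e" using bound[of 0 e] by linarith
  have lip: "\<bar>f (h + y) - f y\<bar> \<le> C * norm h" for h y
  proof -
    have "norm (f (h + y) - f y) \<le> C * norm (h + y - y)"
    proof (rule differentiable_bound)
      show "(f has_derivative f' z) (at z within UNIV)" for z using deriv by simp
      show "onorm (f' z) \<le> C" for z using bound by (intro onorm_le) simp
    qed auto
    then show ?thesis by simp
  qed
  \<comment> \<open>A quotient with step at most \<open>norm e\<close> vanishes outside this enlarged ball\<close>
  define w where "w y = C * norm e * indicator (cball (0::'a) (R + norm e)) y" for y
  have lim: "(\<lambda>m. g m y) \<longlonglongrightarrow> f' y e" for y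
  proof -
    have "((\<lambda>t. f (t *\<^sub>R e + y)) has_derivative (\<lambda>t. f' y (t *\<^sub>R e))) (at (0::real))"
      by (rule has_derivative_compose[of "\<lambda>t. t *\<^sub>R e + y" "\<lambda>t. t *\<^sub>R e"])
        (use deriv in \<open>auto intro!: derivative_eq_intros\<close>)
    moreover have "(\<lambda>t. f' y (t *\<^sub>R e)) = (*) (f' y e)"
      using linear_scale[OF has_derivative_linear[OF deriv]] by (auto simp: fun_eq_iff)
    ultimately have "((\<lambda>t. f (t *\<^sub>R e + y)) has_real_derivative f' y e) (at 0)"
      by (simp add: has_field_derivative_def)
    then have "(\<lambda>t. (f (t *\<^sub>R e + y) - f y) / t) \<midarrow>0\<rightarrow> f' y e"
      by (simp add: DERIV_def)
    moreover have "filterlim (\<lambda>m. 1 / real (Suc m)) (at 0) sequentially"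
      unfolding filterlim_at using LIMSEQ_inverse_real_of_nat by (auto simp: inverse_eq_divide)
    ultimately have "(\<lambda>m. (f ((1 / real (Suc m)) *\<^sub>R e + y) - f y) / (1 / real (Suc m))) \<longlonglongrightarrow> f' y e"
      by (rule filterlim_compose)
    then show ?thesis by (simp add: g_def mult.commute)
  qed
  have dom: "norm (g m y) \<le> w y" for m y
  proof (cases "norm y \<le> R + norm e")
    case True
    have "\<bar>g m y\<bar> \<le> real (Suc m) * (C * norm ((1 / real (Suc m)) *\<^sub>R e))"
      unfolding g_def abs_mult abs_of_nat by (intro mult_left_mono lip) simp
    then show ?thesis using True by (simp add: w_def)
  next
    case False
    have "norm y \<le> norm ((1 / real (Suc m)) *\<^sub>R e + y) + norm ((1 / real (Suc m)) *\<^sub>R e)"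
      using norm_triangle_ineq4[of "(1 / real (Suc m)) *\<^sub>R e + y" "(1 / real (Suc m)) *\<^sub>R e"] by (simp only: add_diff_cancel_left')
    moreover have "norm ((1 / real (Suc m)) *\<^sub>R e) \<le> norm e"
      using mult_left_mono[of 1 "1 + real m" "norm e"] by (simp add: divide_le_eq)
    ultimately have "norm ((1 / real (Suc m)) *\<^sub>R e + y) > R" using False by linarith
    moreover have "norm y > R" using False norm_ge_zero[of e] by linarith
    ultimately have "f ((1 / real (Suc m)) *\<^sub>R e + y) = 0" "f y = 0"
      using zero R linorder_not_le by metis+
    then show ?thesis using C by (simp add: g_def w_def)
  qed
  have wint: "integrable lborel w" 
    using borel_integrable_compact[OF compact_cball continuous_on_const, of "0::'a" "R + norm e" "C * norm e"]
    by (simp add: w_def[abs_def] mult.commute)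
  have gm: "g m \<in> borel_measurable lborel" for m using g0 has_bochner_integral_iff by blast
  have m': "(\<lambda>y. f' y e) \<in> borel_measurable lborel"
    using lim gm by (rule borel_measurable_LIMSEQ_real)
  have "integrable lborel (\<lambda>y. f' y e)"
    by (rule integrable_dominated_convergence[where s=g and w=w]) (use m' gm wint lim dom in auto)
  moreover have "(\<lambda>m. integral\<^sup>L lborel (g m)) \<longlonglongrightarrow> (\<integral>y. f' y e \<partial>lborel)"
    by (rule integral_dominated_convergence[where w=w]) (use m' gm wint lim dom in auto)
  then have "(\<integral>y. f' y e \<partial>lborel) = 0"
    using g0 by (simp add: has_bochner_integral_iff LIMSEQ_const_iff)
  ultimately show ?thesis by (simp add: has_bochner_integral_iff)
qed

lemma norm_matrix_vector_le:
  fixes B :: "real ^ 'n::finite ^ 'm::finite"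
  shows "norm (B *v v) \<le> norm B * norm v"
proof -
  have "norm ((B *v v) $ i) \<le> norm (B $ i) * norm v" for i
  proof -
    have "(B *v v) $ i = B $ i \<bullet> v" by (simp add: matrix_vector_mult_def inner_vec_def)
    then show ?thesis by (simp add: Cauchy_Schwarz_ineq2)
  qed
  then have "norm (B *v v) \<le> norm (\<chi> i. norm (B $ i) * norm v)"
    by (intro norm_le_componentwise_cart) simp
  also have "(\<chi> i. norm (B $ i) * norm v) = norm v *\<^sub>R (\<chi> i. norm (B $ i))"
    by (simp add: vec_eq_iff mult.commute)
  also have "norm \<dots> = norm B * norm v"
    by (simp add: norm_vec_def[where x=B] norm_vec_def[where x="\<chi> i. norm (B $ i)"] mult.commute)
  finally show ?thesis .
qed

lemma integral_trace_derivative_eq_0: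
  fixes K :: "real ^ 'd::finite \<Rightarrow> real ^ 'd"
  assumes "bounded S" and "\<And>y. y \<notin> S \<Longrightarrow> K y = 0"
    and deriv: "\<And>y. (K has_derivative (\<lambda>v. B y *v v)) (at y)"
    and bound: "\<And>y. norm (B y) \<le> C"
  shows "has_bochner_integral lborel (\<lambda>y. trace (B y)) 0"
proof -
  have "has_bochner_integral lborel (\<lambda>y. (B y *v axis i 1) $ i) 0" for i
  proof (rule integral_directional_derivative_eq_0[of S "\<lambda>y. K y $ i" "\<lambda>y v. (B y *v v) $ i" C])
    show "((\<lambda>z. K z $ i) has_derivative (\<lambda>v. (B y *v v) $ i)) (at y)" for y
      using bounded_linear.has_derivative[OF bounded_linear_vec_nth deriv] .
    show "\<bar>(B y *v v) $ i\<bar> \<le> C * norm v" for y v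
      by (rule order_trans[OF component_le_norm_cart order_trans[OF norm_matrix_vector_le]])
        (intro mult_right_mono bound norm_ge_zero)
  qed (use assms in auto)
  then have "has_bochner_integral lborel (\<lambda>y. \<Sum>i\<in>UNIV. (B y *v axis i 1) $ i) (\<Sum>i\<in>(UNIV::'d set). 0)"
    by (rule has_bochner_integral_sum)
  moreover have "(B *v axis i 1) $ i = B $ i $ i" for i and B :: "real ^ 'd ^ 'd"
    by (simp add: matrix_vector_mul_component inner_axis)
  ultimately show ?thesis by (simp add: trace_def)
qed

section \<open>Boundary charts and tangential differentiation\<close>

lemma continuous_on_matrix_vector_mult [continuous_intros]:
  fixes A :: "'a::topological_space \<Rightarrow> real ^ 'n::finite ^ 'm::finite"
  assumes "continuous_on S A" "continuous_on S v"
  shows "continuous_on S (\<lambda>x. A x *v v x)"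
  unfolding matrix_vector_mult_def using assms by (intro continuous_intros)

lemma frontier_open_iff: "open \<Omega> \<Longrightarrow> z \<in> frontier \<Omega> \<longleftrightarrow> z \<in> closure \<Omega> \<and> z \<notin> \<Omega>"
  by (simp add: frontier_def interior_open)

text \<open>
  A local defining function \<open>\<rho>\<close> of \<open>\<Omega>\<close> with gradient \<open>n\<close> and Hessian \<open>M\<close>. That \<open>\<rho>\<close> grows at unit rate
  along the unit vector \<open>e\<close> encodes the graph structure: \<open>y - \<rho> y e\<close> is the projection of \<open>y\<close> to the boundary
  along \<open>e\<close>.
\<close>
locale boundary_chart =
  fixes \<Omega> :: "(real ^ 'd::finite) set" and x :: "real ^ 'd" and r :: real and e :: "real ^ 'd"
    and \<rho> :: "real ^ 'd \<Rightarrow> real" and n :: "real ^ 'd \<Rightarrow> real ^ 'd" and M :: "real ^ 'd \<Rightarrow> real ^ 'd ^ 'd"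
  assumes open_\<Omega>: "open \<Omega>" and r_pos: "r > 0" and norm_e: "norm e = 1"
    and \<rho>_deriv: "\<And>y. (\<rho> has_derivative (\<lambda>v. n y \<bullet> v)) (at y)"
    and n_deriv: "\<And>y. (n has_derivative (\<lambda>v. M y *v v)) (at y)"
    and M_sym: "\<And>y. transpose (M y) = M y"
    and M_cont: "continuous_on UNIV M"
    and \<rho>_shift: "\<And>y t. \<rho> (y + t *\<^sub>R e) = \<rho> y + t"
    and \<Omega>_ball: "\<Omega> \<inter> ball x r = {y \<in> ball x r. \<rho> y > 0}"
begin

lemma \<rho>_cont: "continuous_on S \<rho>"
  using has_derivative_continuous[OF \<rho>_deriv] by (simp add: continuous_at_imp_continuous_on)

lemma n_cont: "continuous_on S n"
  using has_derivative_continuous[OF n_deriv] by (simp add: continuous_at_imp_continuous_on)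

lemma in_\<Omega>_iff: "y \<in> ball x r \<Longrightarrow> y \<in> \<Omega> \<longleftrightarrow> \<rho> y > 0"
  using \<Omega>_ball by blast

lemma n_inner_e: "n y \<bullet> e = 1"
proof -
  have "((\<lambda>t. \<rho> (y + t *\<^sub>R e)) has_derivative (\<lambda>t. n y \<bullet> (t *\<^sub>R e))) (at 0)"
    by (rule has_derivative_compose[of "\<lambda>t. y + t *\<^sub>R e" "\<lambda>t. t *\<^sub>R e"])
      (use \<rho>_deriv in \<open>auto intro!: derivative_eq_intros\<close>)
  then have "((\<lambda>t. \<rho> y + t) has_derivative (\<lambda>t. n y \<bullet> (t *\<^sub>R e))) (at 0)"
    by (simp add: \<rho>_shift)
  moreover have "((\<lambda>t. \<rho> y + t) has_derivative (\<lambda>t. t)) (at 0)"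
    by (auto intro!: derivative_eq_intros)
  ultimately have "(\<lambda>t. n y \<bullet> (t *\<^sub>R e)) = (\<lambda>t. t)"
    by (rule has_derivative_unique)
  then have "n y \<bullet> (1 *\<^sub>R e) = 1" by meson
  then show ?thesis by simp
qed

lemma \<rho>_minus_shift: "\<rho> (y - t *\<^sub>R e) = \<rho> y - t"
  using \<rho>_shift[of y "-t"] by simp

text \<open>
  A zero of \<open>\<rho>\<close> can be pushed into \<open>\<Omega>\<close> by an arbitrarily small multiple of \<open>e\<close>, whereas near a point with
  \<open>\<rho> < 0\<close> there is no point of \<open>\<Omega>\<close>.
\<close>
lemma frontier_iff:
  assumes "z \<in> ball x r"
  shows "z \<in> frontier \<Omega> \<longleftrightarrow> \<rho> z = 0"
proof
  assume fr: "z \<in> frontier \<Omega>"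
  then have "\<not> \<rho> z > 0" using in_\<Omega>_iff[OF assms] by (simp add: frontier_open_iff open_\<Omega>)
  moreover have "\<not> \<rho> z < 0"
  proof
    assume neg: "\<rho> z < 0"
    define U where "U = ball x r \<inter> {y. \<rho> y < 0}"
    have "open U" unfolding U_def
      by (intro open_Int open_ball open_Collect_less \<rho>_cont continuous_on_const)
    moreover have "U \<inter> \<Omega> = {}" using in_\<Omega>_iff by (force simp: U_def)
    ultimately have "U \<inter> closure \<Omega> = {}" by (simp add: open_Int_closure_eq_empty)
    then show False using fr neg assms by (auto simp: frontier_def U_def)
  qed
  ultimately show "\<rho> z = 0" by simp
next
  assume z: "\<rho> z = 0"
  then have "z \<notin> \<Omega>" using in_\<Omega>_iff[OF assms] by simp
  moreover have "z \<in> closure \<Omega>"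
    unfolding closure_approachable
  proof (intro allI impI)
    fix \<epsilon> :: real assume "\<epsilon> > 0"
    define t where "t = min \<epsilon> (r - dist x z) / 2"
    have t: "t > 0" "t < \<epsilon>" "t < r - dist x z"
      using \<open>\<epsilon> > 0\<close> assms by (auto simp: t_def min_def)
    have d: "dist (z + t *\<^sub>R e) z = t" using t norm_e by (simp add: dist_norm)
    then have "z + t *\<^sub>R e \<in> ball x r"
      using t dist_triangle[of x "z + t *\<^sub>R e" z] by (simp add: dist_commute)
    then have "z + t *\<^sub>R e \<in> \<Omega>" using in_\<Omega>_iff z t by (simp add: \<rho>_shift)
    then show "\<exists>y\<in>\<Omega>. dist y z < \<epsilon>" using d t by metis
  qed
  ultimately show "z \<in> frontier \<Omega>" by (simp add: frontier_open_iff open_\<Omega>)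
qed

text \<open>
  The straight line through \<open>z\<close> in direction \<open>\<tau>\<close>, projected to the zero set of \<open>\<rho>\<close> along \<open>e\<close>.
\<close>
definition boundary_curve :: "real ^ 'd \<Rightarrow> real ^ 'd \<Rightarrow> real \<Rightarrow> real ^ 'd" where
  "boundary_curve z \<tau> t = z + t *\<^sub>R \<tau> - \<rho> (z + t *\<^sub>R \<tau>) *\<^sub>R e"

lemma \<rho>_boundary_curve: "\<rho> (boundary_curve z \<tau> t) = 0"
  by (simp add: boundary_curve_def \<rho>_minus_shift)

lemma boundary_curve_deriv:
  "(boundary_curve z \<tau> has_vector_derivative \<tau> - (n (z + t *\<^sub>R \<tau>) \<bullet> \<tau>) *\<^sub>R e) (at t)"
proof -
  have "((\<lambda>t. \<rho> (z + t *\<^sub>R \<tau>)) has_derivative (\<lambda>h. n (z + t *\<^sub>R \<tau>) \<bullet> (h *\<^sub>R \<tau>))) (at t)"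
    by (rule has_derivative_compose[of "\<lambda>t. z + t *\<^sub>R \<tau>" "\<lambda>h. h *\<^sub>R \<tau>"])
      (use \<rho>_deriv in \<open>auto intro!: derivative_eq_intros\<close>)
  then show ?thesis
    unfolding boundary_curve_def has_vector_derivative_def
    by (auto intro!: derivative_eq_intros simp: algebra_simps)
qed

lemma boundary_curve_0: "\<rho> z = 0 \<Longrightarrow> boundary_curve z \<tau> 0 = z"
  by (simp add: boundary_curve_def)

lemma boundary_curve_close:
  assumes "\<rho> z = 0" and "n z \<bullet> \<tau> = 0" and "p > 0" and "q > 0"
  obtains s where "s > 0" and "\<And>t. \<bar>t\<bar> \<le> s \<Longrightarrow> dist (boundary_curve z \<tau> t) z < p"
    and "\<And>t. \<bar>t\<bar> \<le> s \<Longrightarrow> dist (\<tau> - (n (z + t *\<^sub>R \<tau>) \<bullet> \<tau>) *\<^sub>R e) \<tau> < q"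
proof -
  have "continuous_on UNIV (boundary_curve z \<tau>)"
    unfolding boundary_curve_def by (intro continuous_intros continuous_on_compose2[OF \<rho>_cont[of UNIV]]) auto
  then have c: "isCont (boundary_curve z \<tau>) 0"
    by (simp add: continuous_on_eq_continuous_at)
  have "continuous_on UNIV (\<lambda>t. \<tau> - (n (z + t *\<^sub>R \<tau>) \<bullet> \<tau>) *\<^sub>R e)"
    by (intro continuous_intros continuous_on_compose2[OF n_cont[of UNIV]]) auto
  then have c': "isCont (\<lambda>t. \<tau> - (n (z + t *\<^sub>R \<tau>) \<bullet> \<tau>) *\<^sub>R e) 0"
    by (simp add: continuous_on_eq_continuous_at)
  obtain a where "a > 0" and a: "\<And>t. dist t 0 < a \<Longrightarrow> dist (boundary_curve z \<tau> t) z < p"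
    using c \<open>p > 0\<close> boundary_curve_0[OF assms(1)] unfolding continuous_at_eps_delta by metis
  obtain b where "b > 0" and b: "\<And>t. dist t 0 < b \<Longrightarrow> dist (\<tau> - (n (z + t *\<^sub>R \<tau>) \<bullet> \<tau>) *\<^sub>R e) \<tau> < q"
    using c' \<open>q > 0\<close> assms(2) unfolding continuous_at_eps_delta by (auto simp: dist_norm)
  show thesis
    by (rule that[of "min a b / 2"]) (use a b \<open>a > 0\<close> \<open>b > 0\<close> in \<open>auto simp: dist_norm min_def split: if_splits\<close>)
qed

text \<open>
  The witness is the boundary curve, whose velocity at \<open>z\<close> is \<open>\<tau>\<close> because \<open>\<tau>\<close> is orthogonal to \<open>n z\<close>.
\<close>
lemma tangent_vectorsI:
  assumes z: "z \<in> ball x r" "\<rho> z = 0" and "n z \<bullet> \<tau> = 0"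
  shows "\<tau> \<in> tangent_vectors (frontier \<Omega>) z"
proof -
  obtain s where "s > 0" and s: "\<And>t. \<bar>t\<bar> \<le> s \<Longrightarrow> dist (boundary_curve z \<tau> t) z < r - dist x z"
    using boundary_curve_close[OF z(2) assms(3) _ zero_less_one, of "r - dist x z"] z
    by (metis diff_gt_0_iff_gt mem_ball)
  have "boundary_curve z \<tau> t \<in> frontier \<Omega>" if "t \<in> {-s<..<s}" for t
  proof -
    have "dist (boundary_curve z \<tau> t) z < r - dist x z" using s that by auto
    then have "boundary_curve z \<tau> t \<in> ball x r"
      using dist_triangle[of x "boundary_curve z \<tau> t" z] by (simp add: dist_commute)
    then show ?thesis using frontier_iff \<rho>_boundary_curve by blast
  qed
  moreover have "(boundary_curve z \<tau> has_vector_derivative \<tau>) (at 0)"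
    using boundary_curve_deriv[of z \<tau> 0] assms(3) by simp
  ultimately show ?thesis
    unfolding tangent_vectors_def using \<open>s > 0\<close> boundary_curve_0[OF z(2)] by blast
qed

text \<open>
  Any component of the unit normal orthogonal to \<open>n z\<close> would itself be a tangent vector, hence
  orthogonal to the normal and so zero.
\<close>
lemma normal_parallel:
  assumes z: "z \<in> ball x r" "\<rho> z = 0" and m: "outer_unit_normal_at \<Omega> z m"
  obtains c where "c \<noteq> 0" and "m = c *\<^sub>R n z"
proof -
  define c where "c = (m \<bullet> n z) / (n z \<bullet> n z)"
  define w where "w = m - c *\<^sub>R n z"
  have "n z \<noteq> 0" using n_inner_e[of z] by force
  then have nw: "n z \<bullet> w = 0" by (simp add: w_def c_def inner_diff_right inner_commute)
  have "w \<bullet> m = 0"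
    using tangent_vectorsI[OF z nw] m by (simp add: outer_unit_normal_at_def)
  then have "w \<bullet> w = 0" using nw by (simp add: w_def inner_diff_right inner_commute)
  then have "m = c *\<^sub>R n z" by (simp add: w_def)
  moreover have "m \<noteq> 0" using m by (auto simp: outer_unit_normal_at_def)
  ultimately show thesis using that[of c] by auto
qed

lemma inner_n_deriv:
  assumes "C1_closure_field \<Omega> V A" "y \<in> \<Omega>"
  shows "((\<lambda>y. V y \<bullet> n y) has_derivative (\<lambda>w. (A y *v w) \<bullet> n y + V y \<bullet> (M y *v w))) (at y)"
proof -
  have "(V has_derivative (\<lambda>v. A y *v v)) (at y)" using assms by (simp add: C1_closure_field_def)
  from has_derivative_inner[OF this n_deriv] show ?thesis by (simp add: add.commute)
qed

text \<open>
  The chain rule for \<open>\<langle>V, n\<rangle>\<close> along a boundary curve. As \<open>V\<close> is differentiable only inside \<open>\<Omega>\<close>, the curve is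
  shifted into \<open>\<Omega>\<close> by \<open>\<delta> e\<close>. On the shifted curve the mean value theorem applies and the derivative
  is within \<open>\<eta>\<close> of its boundary value \<open>L z \<tau>\<close>, uniformly in \<open>\<delta>\<close>; letting \<open>\<delta>\<close> tend to zero leaves
  \<open>|L z \<tau>| \<le> \<eta>\<close>.
\<close>
lemma tangential_derivative_eq_0:
  assumes V: "C1_closure_field \<Omega> V A"
    and tang: "\<And>y. y \<in> ball x r \<Longrightarrow> y \<in> frontier \<Omega> \<Longrightarrow> V y \<bullet> n y = 0"
    and z: "z \<in> ball x r" "z \<in> frontier \<Omega>" and \<tau>: "n z \<bullet> \<tau> = 0"
  shows "(A z *v \<tau>) \<bullet> n z + V z \<bullet> (M z *v \<tau>) = 0"
proof -
  define L where "L y w = (A y *v w) \<bullet> n y + V y \<bullet> (M y *v w)" for y w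
  define G where "G y = V y \<bullet> n y" for y
  have Vc: "continuous_on (closure \<Omega>) V" and Ac: "continuous_on (closure \<Omega>) A"
    using V by (auto simp: C1_closure_field_def)
  have Lc: "continuous_on (closure \<Omega> \<times> UNIV) (\<lambda>p. L (fst p) (snd p))"
    unfolding L_def
    by (intro continuous_intros continuous_on_compose2[OF Vc] continuous_on_compose2[OF Ac]
        continuous_on_compose2[OF n_cont[of UNIV]] continuous_on_compose2[OF M_cont]) auto
  have Gc: "continuous_on (closure \<Omega>) G"
    unfolding G_def by (intro continuous_intros Vc n_cont)
  have \<rho>z: "\<rho> z = 0" using frontier_iff z by blast
  have zcl: "z \<in> closure \<Omega>" using z by (simp add: frontier_def)
  have "\<bar>L z \<tau>\<bar> \<le> 0"
  proof (rule field_le_epsilon)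
    fix \<eta> :: real assume "\<eta> > 0"
    obtain d where "d > 0" and d: "\<And>p. p \<in> closure \<Omega> \<times> UNIV \<Longrightarrow> dist p (z, \<tau>) < d \<Longrightarrow>
        dist (L (fst p) (snd p)) (L z \<tau>) < \<eta>"
      using Lc[unfolded continuous_on_iff, rule_format, of "(z, \<tau>)" \<eta>] zcl \<open>\<eta> > 0\<close> by auto
    have close: "\<bar>L y w - L z \<tau>\<bar> < \<eta>" if "y \<in> closure \<Omega>" "dist y z < d/2" "dist w \<tau> < d/2" for y w
    proof -
      have "dist (y, w) (z, \<tau>) \<le> dist y z + dist w \<tau>"
        unfolding dist_Pair_Pair by (rule sqrt_sum_squares_le_sum) auto
      then show ?thesis using d[of "(y, w)"] that by (simp add: dist_real_def)
    qed
    \<comment> \<open>Within distance \<open>p\<close> of \<open>z\<close> a point is in the chart and \<open>L\<close> is close to its value at \<open>z\<close>\<close>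
    define p where "p = min (d/2) (r - dist x z)"
    have "p > 0" using \<open>d > 0\<close> z by (simp add: p_def)
    define c where "c = boundary_curve z \<tau>"
    define c' where "c' t = \<tau> - (n (z + t *\<^sub>R \<tau>) \<bullet> \<tau>) *\<^sub>R e" for t
    obtain s where "s > 0" and s: "\<And>t. \<bar>t\<bar> \<le> s \<Longrightarrow> dist (c t) z < p/2"
      and s': "\<And>t. \<bar>t\<bar> \<le> s \<Longrightarrow> dist (c' t) \<tau> < d/2"
      using boundary_curve_close[OF \<rho>z \<tau> half_gt_zero[OF \<open>p > 0\<close>] half_gt_zero[OF \<open>d > 0\<close>]]
      unfolding c_def c'_def by blast
    have near: "dist (c t + \<delta> *\<^sub>R e) z < p" if "\<bar>t\<bar> \<le> s" "0 \<le> \<delta>" "\<delta> < p/2" for t \<delta>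
    proof -
      have "dist (c t + \<delta> *\<^sub>R e) (c t) = \<delta>" using that norm_e by (simp add: dist_norm)
      then show ?thesis using s[OF that(1)] dist_triangle[of "c t + \<delta> *\<^sub>R e" z "c t"] that(3) by linarith
    qed
    have nearball: "c t + \<delta> *\<^sub>R e \<in> ball x r" if "\<bar>t\<bar> \<le> s" "0 \<le> \<delta>" "\<delta> < p/2" for t \<delta>
      using near[OF that] dist_triangle[of x "c t + \<delta> *\<^sub>R e" z] by (simp add: p_def dist_commute)
    have \<rho>c: "\<rho> (c t + \<delta> *\<^sub>R e) = \<delta>" for t \<delta> by (simp add: c_def \<rho>_shift \<rho>_boundary_curve)
    have in\<Omega>: "c t + \<delta> *\<^sub>R e \<in> \<Omega>" if "\<bar>t\<bar> \<le> s" "0 < \<delta>" "\<delta> < p/2" for t \<delta>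
      using nearball[of t \<delta>] in_\<Omega>_iff \<rho>c that by simp
    have fr: "c t \<in> frontier \<Omega>" "G (c t) = 0" if "\<bar>t\<bar> \<le> s" for t
      using nearball[of t 0] frontier_iff[of "c t"] \<rho>c[of t 0] that tang[of "c t"] \<open>p > 0\<close> by (auto simp: G_def)
    have est: "\<bar>G (c s + \<delta> *\<^sub>R e) - G (c 0 + \<delta> *\<^sub>R e) - s * L z \<tau>\<bar> \<le> s * \<eta>" if \<delta>: "0 < \<delta>" "\<delta> < p/2" for \<delta>
    proof -
      have "\<exists>t>0. t < s \<and> G (c s + \<delta> *\<^sub>R e) - G (c 0 + \<delta> *\<^sub>R e) = (s - 0) * L (c t + \<delta> *\<^sub>R e) (c' t)"
      proof (rule MVT2)
        fix t assume t: "0 \<le> t" "t \<le> s"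
        have "((\<lambda>t. c t + \<delta> *\<^sub>R e) has_derivative (\<lambda>h. h *\<^sub>R c' t)) (at t)"
          using boundary_curve_deriv[of z \<tau> t] unfolding c_def c'_def has_vector_derivative_def
          by (auto intro!: derivative_eq_intros)
        then have "((\<lambda>t. G (c t + \<delta> *\<^sub>R e)) has_derivative (\<lambda>h. L (c t + \<delta> *\<^sub>R e) (h *\<^sub>R c' t))) (at t)"
          unfolding G_def L_def
          by (rule has_derivative_compose[OF _ inner_n_deriv[OF V]]) (use in\<Omega> t \<delta> in auto)
        moreover have "(\<lambda>h. L (c t + \<delta> *\<^sub>R e) (h *\<^sub>R c' t)) = (*) (L (c t + \<delta> *\<^sub>R e) (c' t))"
          by (auto simp: L_def fun_eq_iff matrix_vector_mult_scaleR algebra_simps)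
        ultimately show "((\<lambda>t. G (c t + \<delta> *\<^sub>R e)) has_real_derivative L (c t + \<delta> *\<^sub>R e) (c' t)) (at t)"
          by (simp add: has_field_derivative_def)
      qed (use \<open>s > 0\<close> in auto)
      then obtain t where t: "0 < t" "t < s" and
        eq: "G (c s + \<delta> *\<^sub>R e) - G (c 0 + \<delta> *\<^sub>R e) = s * L (c t + \<delta> *\<^sub>R e) (c' t)" by auto
      have "\<bar>L (c t + \<delta> *\<^sub>R e) (c' t) - L z \<tau>\<bar> < \<eta>"
        using near[of t \<delta>] in\<Omega>[of t \<delta>] s'[of t] t \<delta> closure_subset[of \<Omega>]
        by (intro close) (auto simp: p_def)
      then have "s * \<bar>L (c t + \<delta> *\<^sub>R e) (c' t) - L z \<tau>\<bar> \<le> s * \<eta>" using \<open>s > 0\<close> by simp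
      then show ?thesis
        unfolding eq using \<open>s > 0\<close> by (simp add: right_diff_distrib[symmetric] abs_mult)
    qed
    have lim: "((\<lambda>\<delta>. G (c t + \<delta> *\<^sub>R e)) \<longlongrightarrow> 0) (at_right 0)" if t: "\<bar>t\<bar> \<le> s" for t
    proof -
      have "((\<lambda>\<delta>. c t + \<delta> *\<^sub>R e) \<longlongrightarrow> c t + 0 *\<^sub>R e) (at_right 0)"
        by (intro tendsto_intros)
      moreover have "\<forall>\<^sub>F \<delta> in at_right 0. c t + \<delta> *\<^sub>R e \<in> closure \<Omega>"
        unfolding eventually_at_right_field
        using in\<Omega>[OF t] \<open>p > 0\<close> closure_subset[of \<Omega>] by (intro exI[of _ "p/2"]) auto
      ultimately have "((\<lambda>\<delta>. G (c t + \<delta> *\<^sub>R e)) \<longlongrightarrow> G (c t)) (at_right 0)"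
        using fr(1)[OF t] by (intro continuous_on_tendsto_compose[OF Gc]) (auto simp: frontier_def)
      then show ?thesis using fr(2)[OF t] by simp
    qed
    have "((\<lambda>\<delta>. \<bar>G (c s + \<delta> *\<^sub>R e) - G (c 0 + \<delta> *\<^sub>R e) - s * L z \<tau>\<bar>) \<longlongrightarrow> \<bar>0 - 0 - s * L z \<tau>\<bar>) (at_right 0)"
      using \<open>s > 0\<close> by (intro tendsto_intros lim) auto
    moreover have "\<forall>\<^sub>F \<delta> in at_right 0. \<bar>G (c s + \<delta> *\<^sub>R e) - G (c 0 + \<delta> *\<^sub>R e) - s * L z \<tau>\<bar> \<le> s * \<eta>"
      unfolding eventually_at_right_field using est \<open>p > 0\<close> by (intro exI[of _ "p/2"]) auto
    ultimately have "\<bar>0 - 0 - s * L z \<tau>\<bar> \<le> s * \<eta>"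
      by (rule tendsto_upperbound) simp
    then show "\<bar>L z \<tau>\<bar> \<le> 0 + \<eta>" using \<open>s > 0\<close> by (simp add: abs_mult)
  qed
  then show ?thesis by (simp add: L_def)
qed

end

text \<open>
  With \<open>\<rho> y = s y\<^sub>k - \<gamma> y\<close> and \<open>e\<close> the \<open>k\<close>-th axis vector with sign \<open>s\<close>: the graph function does not depend on the
  \<open>k\<close>-th coordinate, so \<open>\<rho>\<close> grows at unit rate along \<open>e\<close>.
\<close>
lemma smooth_boundary_chart:
  fixes \<Omega> :: "(real ^ 'd::finite) set"
  assumes "open \<Omega>" "smooth_boundary \<Omega>" "x \<in> frontier \<Omega>"
  obtains r e \<rho> n M where "boundary_chart \<Omega> x r e \<rho> n M"
proof -
  obtain r k s \<gamma> where r: "r > 0" and s: "s \<in> {-1, 1::real}" and \<gamma>: "smooth \<gamma>"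
    and inv: "\<And>y t. \<gamma> (y + t *\<^sub>R axis k 1) = \<gamma> y"
    and loc: "\<Omega> \<inter> ball x r = {y \<in> ball x r. s * y $ k > \<gamma> y}"
    using assms(2)[unfolded smooth_boundary_def, rule_format, OF assms(3)] by blast
  define n where "n y = s *\<^sub>R axis k 1 - grad UNIV \<gamma> y" for y
  define M where "M y = - jacobian UNIV (grad UNIV \<gamma>) y" for y
  have C2: "Ck_closure (Suc (Suc 0)) UNIV \<gamma>" using \<gamma> unfolding smooth_def by blast
  have g1: "(\<gamma> has_derivative (\<lambda>v. grad UNIV \<gamma> y \<bullet> v)) (at y)" for y
    by (rule Ck_closure_has_derivative[OF open_UNIV C2]) simp
  have J: "C1_closure_field UNIV (grad UNIV \<gamma>) (jacobian UNIV (grad UNIV \<gamma>))"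
    by (rule C1_closure_field_jacobian[OF open_UNIV vec_Ck_closure_grad[OF C2]])
  have "boundary_chart \<Omega> x r (s *\<^sub>R axis k 1) (\<lambda>y. s * y $ k - \<gamma> y) n M"
  proof
    show "norm (s *\<^sub>R axis k (1::real)) = 1" using s by auto
    show "((\<lambda>y. s * y $ k - \<gamma> y) has_derivative (\<bullet>) (n y)) (at y)" for y
    proof -
      have "((\<lambda>y. s * y $ k - \<gamma> y) has_derivative (\<lambda>v. s * v $ k - grad UNIV \<gamma> y \<bullet> v)) (at y)"
        by (intro has_derivative_diff has_derivative_mult_right g1
            bounded_linear.has_derivative[OF bounded_linear_vec_nth] has_derivative_ident)
      moreover have "(\<bullet>) (n y) = (\<lambda>v. s * v $ k - grad UNIV \<gamma> y \<bullet> v)"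
        by (auto simp: fun_eq_iff n_def inner_diff_left inner_axis')
      ultimately show ?thesis by simp
    qed
    show "(n has_derivative (*v) (M y)) (at y)" for y
    proof -
      have "(grad UNIV \<gamma> has_derivative (\<lambda>v. jacobian UNIV (grad UNIV \<gamma>) y *v v)) (at y)"
        using J by (simp add: C1_closure_field_def)
      then have "(n has_derivative (\<lambda>v. 0 - jacobian UNIV (grad UNIV \<gamma>) y *v v)) (at y)"
        unfolding n_def by (intro has_derivative_diff has_derivative_const)
      moreover have "0 - B *v v = (- B) *v v" for B :: "real ^ 'd ^ 'd" and v
        by (simp add: matrix_vector_mult_def vec_eq_iff sum_negf)
      ultimately show ?thesis unfolding M_def by simp
    qed
    show "transpose (M y) = M y" for y
      using jacobian_grad_symmetric[OF open_UNIV C2, of y]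
      by (simp add: M_def transpose_def vec_eq_iff)
    show "continuous_on UNIV M"
      using J unfolding M_def C1_closure_field_def by (auto intro: continuous_on_minus)
    show "s * (y + t *\<^sub>R s *\<^sub>R axis k 1) $ k - \<gamma> (y + t *\<^sub>R s *\<^sub>R axis k 1) = s * y $ k - \<gamma> y + t" for y t
      using s inv[of y "t * s"] by (auto simp: algebra_simps)
    show "\<Omega> \<inter> ball x r = {y \<in> ball x r. s * y $ k - \<gamma> y > 0}" using loc by auto
  qed (use assms(1) r in auto)
  then show thesis by (rule that)
qed

section \<open>The divergence theorem for tangential fields\<close>

definition outer_product :: "real ^ 'd::finite \<Rightarrow> real ^ 'd \<Rightarrow> real ^ 'd ^ 'd" where
  "outer_product a b = (\<chi> i j. a $ i * b $ j)"

lemma outer_product_mult_vec: "outer_product a b *v v = (b \<bullet> v) *\<^sub>R a"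
  by (simp add: outer_product_def matrix_vector_mult_def inner_vec_def vec_eq_iff sum_distrib_left mult_ac)

lemma trace_outer_product: "trace (outer_product a b) = a \<bullet> b"
  by (simp add: outer_product_def trace_def inner_vec_def)

lemma continuous_on_outer_product [continuous_intros]:
  assumes "continuous_on S a" "continuous_on S b"
  shows "continuous_on S (\<lambda>x. outer_product (a x) (b x))"
  unfolding outer_product_def using assms by (intro continuous_intros)

lemma trace_zero: "trace (0 :: real ^ 'd::finite ^ 'd) = 0"
  by (simp add: trace_def)

lemma trace_scaleR: "trace (c *\<^sub>R A) = c * trace A" for A :: "real ^ 'd::finite ^ 'd"
  by (simp add: trace_def sum_distrib_left)

lemma continuous_on_trace [continuous_intros]:
  fixes A :: "'a::topological_space \<Rightarrow> real ^ 'd::finite ^ 'd"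
  shows "continuous_on S A \<Longrightarrow> continuous_on S (\<lambda>x. trace (A x))"
  unfolding trace_def by (intro continuous_intros)

lemma continuous_on_compact_bound:
  fixes f :: "'a::topological_space \<Rightarrow> 'b::real_normed_vector"
  assumes "compact S" "continuous_on S f"
  obtains C where "C \<ge> 0" "\<And>y. y \<in> S \<Longrightarrow> norm (f y) \<le> C"
proof -
  have "bounded (f ` S)" using assms compact_continuous_image compact_imp_bounded by blast
  then obtain C where "\<forall>y\<in>S. norm (f y) \<le> C" unfolding bounded_iff by blast
  then show thesis using that[of "max 0 C"] by (auto simp: le_max_iff_disj)
qed

lemma has_derivative_0_comparison:
  assumes g: "(g has_derivative (\<lambda>_. 0)) (at y)" and "g y = 0"
    and le: "\<And>z. norm (f z) \<le> C * norm (g z)"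
  shows "(f has_derivative (\<lambda>_. 0)) (at y)"
  unfolding has_derivative_at_alt
proof (intro conjI allI impI)
  fix \<epsilon> :: real assume "\<epsilon> > 0"
  then have "\<epsilon> / (\<bar>C\<bar> + 1) > 0" by simp
  then obtain d where "d > 0" and d: "\<And>z. norm (z - y) < d \<Longrightarrow> norm (g z) \<le> \<epsilon> / (\<bar>C\<bar> + 1) * norm (z - y)"
    using g \<open>g y = 0\<close> unfolding has_derivative_at_alt by (metis diff_zero)
  have fy: "f y = 0" using le[of y] \<open>g y = 0\<close> by simp
  have "norm (f z - f y - 0) \<le> \<epsilon> * norm (z - y)" if z: "norm (z - y) < d" for z
  proof -
    have "norm (f z) \<le> C * norm (g z)" by (rule le)
    also have "\<dots> \<le> (\<bar>C\<bar> + 1) * norm (g z)" by (rule mult_right_mono) auto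
    also have "\<dots> \<le> (\<bar>C\<bar> + 1) * (\<epsilon> / (\<bar>C\<bar> + 1) * norm (z - y))"
      using d[OF z] by (rule mult_left_mono) simp
    also have "\<dots> = \<epsilon> * norm (z - y)" by simp
    finally show ?thesis using fy by simp
  qed
  then show "\<exists>d>0. \<forall>z. norm (z - y) < d \<longrightarrow> norm (f z - f y - 0) \<le> \<epsilon> * norm (z - y)"
    using \<open>d > 0\<close> by blast
qed simp

lemma has_derivative_0_of_vanishing:
  assumes "open U" "y \<in> U" "\<And>z. z \<in> U \<Longrightarrow> f z = 0"
  shows "(f has_derivative (\<lambda>_. 0)) (at y)"
  by (rule has_derivative_transform_within_open[OF has_derivative_const[of 0] assms(1,2)])
    (simp add: assms(3))

lemma C1_closure_field_vanishing:
  assumes V: "C1_closure_field \<Omega> V A" and "open U" "y \<in> U" "U \<subseteq> \<Omega>" "\<And>z. z \<in> U \<Longrightarrow> V z = 0"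
  shows "A y = 0"
proof -
  have "(V has_derivative (\<lambda>v. A y *v v)) (at y)"
    using V assms(3,4) by (auto simp: C1_closure_field_def)
  moreover have "(V has_derivative (\<lambda>_. 0)) (at y)"
    using assms by (intro has_derivative_0_of_vanishing[of U])
  ultimately have "(\<lambda>v. A y *v v) = (\<lambda>_. 0)" by (rule has_derivative_unique)
  then show ?thesis by (metis matrix_eq matrix_vector_mult_0)
qed

lemma C1_closure_field_scaleR:
  assumes V: "C1_closure_field \<Omega> V A" and f: "continuous_on (closure \<Omega>) f" and g: "continuous_on (closure \<Omega>) g"
    and fg: "\<And>y. y \<in> \<Omega> \<Longrightarrow> (f has_derivative (\<lambda>v. g y \<bullet> v)) (at y)"
  shows "C1_closure_field \<Omega> (\<lambda>y. f y *\<^sub>R V y) (\<lambda>y. f y *\<^sub>R A y + outer_product (V y) (g y))"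
  unfolding C1_closure_field_def
proof (intro conjI ballI)
  show "continuous_on (closure \<Omega>) (\<lambda>y. f y *\<^sub>R V y)"
    "continuous_on (closure \<Omega>) (\<lambda>y. f y *\<^sub>R A y + outer_product (V y) (g y))"
    using V f g by (auto intro!: continuous_intros simp: C1_closure_field_def)
  fix y assume y: "y \<in> \<Omega>"
  have "(V has_derivative (\<lambda>v. A y *v v)) (at y)" using V y by (simp add: C1_closure_field_def)
  from has_derivative_scaleR[OF fg[OF y] this]
  show "((\<lambda>y. f y *\<^sub>R V y) has_derivative (\<lambda>v. (f y *\<^sub>R A y + outer_product (V y) (g y)) *v v)) (at y)"
    by (simp add: matrix_vector_mult_add_rdistrib outer_product_mult_vec scaleR_matrix_vector_assoc)
qed

context boundary_chart
begin

text \<open>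
  \<open>cutoff_slope\<close> is the factor of \<open>n\<close> in the gradient. A rational function of \<open>\<rho>\<close> suffices in place of a
  compactly supported cutoff, since vanishing to second order at the boundary is enough for the
  extension by zero.
\<close>
definition cutoff :: "real \<Rightarrow> real ^ 'd \<Rightarrow> real" where
  "cutoff \<epsilon> y = (\<rho> y)\<^sup>2 / (\<epsilon>\<^sup>2 + (\<rho> y)\<^sup>2)"

definition cutoff_slope :: "real \<Rightarrow> real ^ 'd \<Rightarrow> real" where
  "cutoff_slope \<epsilon> y = 2 * \<rho> y * \<epsilon>\<^sup>2 / (\<epsilon>\<^sup>2 + (\<rho> y)\<^sup>2)\<^sup>2"

lemma cutoff_deriv:
  assumes "\<epsilon> > 0"
  shows "(cutoff \<epsilon> has_derivative (\<lambda>v. (cutoff_slope \<epsilon> y *\<^sub>R n y) \<bullet> v)) (at y)"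
proof -
  have pos: "\<epsilon>\<^sup>2 + t\<^sup>2 > 0" for t :: real using assms by (simp add: add_pos_nonneg)
  have "((\<lambda>t. t\<^sup>2 / (\<epsilon>\<^sup>2 + t\<^sup>2)) has_real_derivative 2 * t * \<epsilon>\<^sup>2 / (\<epsilon>\<^sup>2 + t\<^sup>2)\<^sup>2) (at t)" for t
  proof -
    have num: "((\<lambda>t. t\<^sup>2) has_real_derivative 2 * t) (at t)"
      and den: "((\<lambda>t. \<epsilon>\<^sup>2 + t\<^sup>2) has_real_derivative 2 * t) (at t)"
      by (auto intro!: derivative_eq_intros)
    have "\<epsilon>\<^sup>2 + t\<^sup>2 \<noteq> 0" using pos[of t] by linarith
    from DERIV_divide[OF num den this]
    have "((\<lambda>t. t\<^sup>2 / (\<epsilon>\<^sup>2 + t\<^sup>2)) has_real_derivative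
        (2 * t * (\<epsilon>\<^sup>2 + t\<^sup>2) - t\<^sup>2 * (2 * t)) / ((\<epsilon>\<^sup>2 + t\<^sup>2) * (\<epsilon>\<^sup>2 + t\<^sup>2))) (at t)" .
    moreover have "2 * t * (\<epsilon>\<^sup>2 + t\<^sup>2) - t\<^sup>2 * (2 * t) = 2 * t * \<epsilon>\<^sup>2" by (simp add: algebra_simps)
    ultimately show ?thesis by (simp only: power2_eq_square[of "\<epsilon>\<^sup>2 + t\<^sup>2"])
  qed
  then have "((\<lambda>t. t\<^sup>2 / (\<epsilon>\<^sup>2 + t\<^sup>2)) has_derivative (*) (cutoff_slope \<epsilon> y)) (at (\<rho> y))"
    unfolding cutoff_slope_def has_field_derivative_def .
  from has_derivative_compose[OF \<rho>_deriv this]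
  show ?thesis unfolding cutoff_def[abs_def] by simp
qed

text \<open>
  The bound does not depend on \<open>\<epsilon>\<close>; this is the reason why no estimate of the volume of a boundary
  layer is needed. It comes from \<open>2 \<rho>\<^sup>2 \<epsilon>\<^sup>2 \<le> (\<epsilon>\<^sup>2 + \<rho>\<^sup>2)\<^sup>2\<close>.
\<close>
lemma cutoff_slope_bound:
  assumes "\<epsilon> > 0" "\<bar>a\<bar> \<le> C * \<rho> y" "\<rho> y > 0"
  shows "\<bar>cutoff_slope \<epsilon> y * a\<bar> \<le> C"
proof -
  have pos: "(\<epsilon>\<^sup>2 + (\<rho> y)\<^sup>2)\<^sup>2 > 0" using assms by (simp add: add_pos_pos)
  have "C \<ge> 0" 
  proof (rule ccontr)
    assume "\<not> C \<ge> 0"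
    then have "C * \<rho> y < 0" using \<open>\<rho> y > 0\<close> by (intro mult_neg_pos) auto
    then show False using assms(2) by linarith
  qed
  have "2 * \<rho> y * \<epsilon>\<^sup>2 * \<rho> y \<le> (\<epsilon>\<^sup>2 + (\<rho> y)\<^sup>2)\<^sup>2"
  proof -
    have "(\<epsilon>\<^sup>2 + (\<rho> y)\<^sup>2)\<^sup>2 = 2 * \<rho> y * \<epsilon>\<^sup>2 * \<rho> y + (\<epsilon>\<^sup>2)\<^sup>2 + ((\<rho> y)\<^sup>2)\<^sup>2"
      by (simp add: power2_eq_square algebra_simps)
    then show ?thesis by simp
  qed
  then have le1: "cutoff_slope \<epsilon> y * \<rho> y \<le> 1" using pos by (simp add: cutoff_slope_def divide_le_eq)
  have nn: "cutoff_slope \<epsilon> y \<ge> 0" using assms by (simp add: cutoff_slope_def)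
  have "\<bar>cutoff_slope \<epsilon> y * a\<bar> \<le> cutoff_slope \<epsilon> y * (C * \<rho> y)"
    using nn assms(2) by (simp add: abs_mult mult_left_mono)
  also have "\<dots> = C * (cutoff_slope \<epsilon> y * \<rho> y)" by simp
  also have "\<dots> \<le> C" using le1 \<open>C \<ge> 0\<close> by (simp add: mult_left_le)
  finally show ?thesis .
qed

lemma cutoff_tendsto:
  assumes "\<rho> y > 0"
  shows "(\<lambda>m. cutoff (1 / real (Suc m)) y) \<longlonglongrightarrow> 1" and "(\<lambda>m. cutoff_slope (1 / real (Suc m)) y) \<longlonglongrightarrow> 0"
proof -
  have lim: "(\<lambda>m. 1 / real (Suc m)) \<longlonglongrightarrow> 0" using LIMSEQ_inverse_real_of_nat by (simp add: inverse_eq_divide)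
  have "(\<lambda>m. cutoff (1 / real (Suc m)) y) \<longlonglongrightarrow> (\<rho> y)\<^sup>2 / (0\<^sup>2 + (\<rho> y)\<^sup>2)"
    unfolding cutoff_def using assms by (intro tendsto_intros lim) auto
  then show "(\<lambda>m. cutoff (1 / real (Suc m)) y) \<longlonglongrightarrow> 1" using assms by simp
  have "(\<lambda>m. cutoff_slope (1 / real (Suc m)) y) \<longlonglongrightarrow> 2 * \<rho> y * 0\<^sup>2 / (0\<^sup>2 + (\<rho> y)\<^sup>2)\<^sup>2"
    unfolding cutoff_slope_def using assms by (intro tendsto_intros lim) auto
  then show "(\<lambda>m. cutoff_slope (1 / real (Suc m)) y) \<longlonglongrightarrow> 0" by simp
qed

text \<open>
  Walking from \<open>y\<close> against \<open>e\<close> reaches the boundary after time \<open>\<rho> y\<close>. There \<open>\<langle>V, n\<rangle>\<close> vanishes, and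
  along the way its derivative is bounded. The conditions on \<open>q\<close> keep the walk inside the chart.
\<close>
lemma inner_n_le_\<rho>:
  assumes "bounded \<Omega>" and V: "C1_closure_field \<Omega> V A"
    and tang: "\<And>y. y \<in> ball x r \<Longrightarrow> y \<in> frontier \<Omega> \<Longrightarrow> V y \<bullet> n y = 0"
    and q: "q \<le> r / 2" and small: "\<And>y. y \<in> cball x q \<Longrightarrow> \<bar>\<rho> y\<bar> < r / 2"
  obtains C where "C \<ge> 0" and "\<And>y. y \<in> \<Omega> \<Longrightarrow> y \<in> cball x q \<Longrightarrow> \<bar>V y \<bullet> n y\<bar> \<le> C * \<rho> y"
proof -
  define L where "L y = (A y *v e) \<bullet> n y + V y \<bullet> (M y *v e)" for y
  have Vc: "continuous_on (closure \<Omega>) V" and Ac: "continuous_on (closure \<Omega>) A"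
    using V by (auto simp: C1_closure_field_def)
  have "continuous_on (closure \<Omega>) L"
    unfolding L_def by (intro continuous_intros Vc Ac n_cont continuous_on_subset[OF M_cont]) auto
  then obtain C where "C \<ge> 0" and C: "\<And>y. y \<in> closure \<Omega> \<Longrightarrow> norm (L y) \<le> C"
    using continuous_on_compact_bound \<open>bounded \<Omega>\<close> compact_closure by metis
  show thesis
  proof (rule that[OF \<open>C \<ge> 0\<close>])
    fix y assume y: "y \<in> \<Omega>" "y \<in> cball x q"
    have "y \<in> ball x r" using y q r_pos by auto
    then have \<rho>y: "\<rho> y > 0" using y in_\<Omega>_iff by blast
    have inball: "y - t *\<^sub>R e \<in> ball x r" if "0 \<le> t" "t \<le> \<rho> y" for t
    proof -
      have "dist (y - t *\<^sub>R e) y = t" using that norm_e by (simp add: dist_norm)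
      then have "dist x (y - t *\<^sub>R e) \<le> dist x y + t"
        using dist_triangle[of x "y - t *\<^sub>R e" y] by (simp add: dist_commute)
      moreover have "dist x y \<le> q" "t < r/2" using y small[OF y(2)] that by auto
      ultimately show ?thesis using q by simp
    qed
    have in\<Omega>: "y - t *\<^sub>R e \<in> \<Omega>" if "0 \<le> t" "t < \<rho> y" for t
      using in_\<Omega>_iff[OF inball] that by (simp add: \<rho>_minus_shift)
    have fr: "y - \<rho> y *\<^sub>R e \<in> frontier \<Omega>"
      using frontier_iff[OF inball] \<rho>y by (simp add: \<rho>_minus_shift)
    have cl: "y - t *\<^sub>R e \<in> closure \<Omega>" if "0 \<le> t" "t \<le> \<rho> y" for t
      using in\<Omega>[of t] fr that closure_subset[of \<Omega>] by (cases "t = \<rho> y") (auto simp: frontier_def)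
    define G where "G t = V (y - t *\<^sub>R e) \<bullet> n (y - t *\<^sub>R e)" for t
    have Gc: "continuous_on {0..\<rho> y} G"
      unfolding G_def
      by (intro continuous_intros continuous_on_compose2[OF Vc] continuous_on_compose2[OF n_cont[of UNIV]])
        (use cl in auto)
    have Gd: "(G has_derivative (\<lambda>h. - h * L (y - t *\<^sub>R e))) (at t)" if "0 < t" "t < \<rho> y" for t
    proof -
      have "((\<lambda>t. y - t *\<^sub>R e) has_derivative (\<lambda>h. (- h) *\<^sub>R e)) (at t)"
        by (auto intro!: derivative_eq_intros)
      moreover have "(A z *v ((- h) *\<^sub>R e)) \<bullet> n z + V z \<bullet> (M z *v ((- h) *\<^sub>R e)) = - h * L z" for z h
        by (simp only: L_def matrix_vector_mult_scaleR inner_scaleR_left inner_scaleR_right distrib_left)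
      moreover have "((\<lambda>y. V y \<bullet> n y) has_derivative
          (\<lambda>w. (A (y - t *\<^sub>R e) *v w) \<bullet> n (y - t *\<^sub>R e) + V (y - t *\<^sub>R e) \<bullet> (M (y - t *\<^sub>R e) *v w)))
          (at (y - t *\<^sub>R e))"
        using that by (intro inner_n_deriv[OF V in\<Omega>]) auto
      ultimately show ?thesis
        unfolding G_def using has_derivative_compose by fastforce
    qed
    obtain t where t: "0 < t" "t < \<rho> y" and eq: "G (\<rho> y) - G 0 = - (\<rho> y - 0) * L (y - t *\<^sub>R e)"
      using mvt[OF \<rho>y Gc Gd] by blast
    have "G (\<rho> y) = 0" unfolding G_def using tang fr inball[of "\<rho> y"] \<rho>y by simp
    then have "\<bar>V y \<bullet> n y\<bar> = \<rho> y * \<bar>L (y - t *\<^sub>R e)\<bar>"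
      using eq \<rho>y by (simp add: G_def abs_mult)
    also have "\<dots> \<le> \<rho> y * C"
      using C[OF cl, of t] t \<rho>y by (intro mult_left_mono) auto
    finally show "\<bar>V y \<bullet> n y\<bar> \<le> C * \<rho> y" by (simp add: mult.commute)
  qed
qed

text \<open>
  The extension by zero is differentiable at boundary points because the cutoff vanishes there to second
  order in \<open>\<rho>\<close>, so that the product is dominated by a multiple of \<open>\<rho>\<^sup>2\<close>.
\<close>
lemma cutoff_extension_has_derivative:
  assumes "\<epsilon> > 0" and V: "C1_closure_field \<Omega> V A" and "bounded \<Omega>"
    and q: "q < r" and supp: "\<And>y. y \<in> \<Omega> \<Longrightarrow> y \<notin> cball x q \<Longrightarrow> V y = 0"
  shows "((\<lambda>y. if y \<in> \<Omega> then cutoff \<epsilon> y *\<^sub>R V y else 0) has_derivative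
     (\<lambda>v. (if y \<in> \<Omega> then cutoff \<epsilon> y *\<^sub>R A y + outer_product (V y) (cutoff_slope \<epsilon> y *\<^sub>R n y) else 0) *v v)) (at y)"
    (is "(?K has_derivative _) _")
proof (cases "y \<in> \<Omega>")
  case True
  have "(V has_derivative (\<lambda>v. A y *v v)) (at y)" using V True by (simp add: C1_closure_field_def)
  from has_derivative_scaleR[OF cutoff_deriv[OF \<open>\<epsilon> > 0\<close>] this]
  have "((\<lambda>y. cutoff \<epsilon> y *\<^sub>R V y) has_derivative
     (\<lambda>v. (cutoff \<epsilon> y *\<^sub>R A y + outer_product (V y) (cutoff_slope \<epsilon> y *\<^sub>R n y)) *v v)) (at y)"
    by (simp add: matrix_vector_mult_add_rdistrib outer_product_mult_vec scaleR_matrix_vector_assoc)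
  then have "(?K has_derivative (\<lambda>v. (cutoff \<epsilon> y *\<^sub>R A y + outer_product (V y) (cutoff_slope \<epsilon> y *\<^sub>R n y)) *v v)) (at y)"
    by (rule has_derivative_transform_within_open[OF _ open_\<Omega> True]) simp
  then show ?thesis using True by simp
next
  case False
  have "(?K has_derivative (\<lambda>_. 0)) (at y)"
  proof (cases "y \<in> closure \<Omega> \<inter> cball x q")
    case out: False
    show ?thesis
    proof (rule has_derivative_0_of_vanishing)
      show "open (- (closure \<Omega> \<inter> cball x q))" by (intro open_Compl closed_Int) auto
      show "?K z = 0" if "z \<in> - (closure \<Omega> \<inter> cball x q)" for z
        using that supp closure_subset[of \<Omega>] by auto
    qed (use out in auto)
  next
    case True
    then have "y \<in> ball x r" "y \<in> frontier \<Omega>"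
      using q False by (auto simp: frontier_open_iff open_\<Omega>)
    then have \<rho>y: "\<rho> y = 0" using frontier_iff by blast
    have Vc: "continuous_on (closure \<Omega>) V" using V by (simp add: C1_closure_field_def)
    then obtain C where "C \<ge> 0" and C: "\<And>y. y \<in> closure \<Omega> \<Longrightarrow> norm (V y) \<le> C"
      using continuous_on_compact_bound \<open>bounded \<Omega>\<close> compact_closure by metis
    show ?thesis
    proof (rule has_derivative_0_comparison[where g="\<lambda>z. (\<rho> z)\<^sup>2" and C="C / \<epsilon>\<^sup>2"])
      have "((\<lambda>z. (\<rho> z)\<^sup>2) has_derivative (\<lambda>v. 2 * (n y \<bullet> v) * \<rho> y ^ (2 - 1))) (at y)"
        by (auto intro!: derivative_eq_intros \<rho>_deriv)
      then show "((\<lambda>z. (\<rho> z)\<^sup>2) has_derivative (\<lambda>_. 0)) (at y)" by (simp add: \<rho>y)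
      show "norm (?K z) \<le> C / \<epsilon>\<^sup>2 * norm ((\<rho> z)\<^sup>2)" for z
      proof (cases "z \<in> \<Omega>")
        case z: True
        have "cutoff \<epsilon> z \<le> (\<rho> z)\<^sup>2 / \<epsilon>\<^sup>2"
          unfolding cutoff_def using \<open>\<epsilon> > 0\<close> by (intro divide_left_mono) (auto simp: add_pos_nonneg)
        moreover have "cutoff \<epsilon> z \<ge> 0" by (simp add: cutoff_def)
        moreover have "norm (V z) \<le> C" using C z closure_subset[of \<Omega>] by blast
        ultimately have "cutoff \<epsilon> z * norm (V z) \<le> (\<rho> z)\<^sup>2 / \<epsilon>\<^sup>2 * C"
          using \<open>C \<ge> 0\<close> by (intro mult_mono) auto
        then show ?thesis using z \<open>cutoff \<epsilon> z \<ge> 0\<close> by (simp add: mult.commute)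
      qed (use \<open>C \<ge> 0\<close> in auto)
    qed (simp add: \<rho>y)
  qed
  then show ?thesis using False by (simp add: matrix_vector_mult_0)
qed

text \<open>
  The divergence theorem for a tangential field supported in a chart: the fields cut off at scale \<open>\<epsilon>\<close>
  have divergence integral zero, and \<open>\<epsilon> \<rightarrow> 0\<close> is taken by dominated convergence.
\<close>
lemma integral_divergence_near_boundary:
  assumes "bounded \<Omega>" and V: "C1_closure_field \<Omega> V A"
    and tang: "\<And>y. y \<in> ball x r \<Longrightarrow> y \<in> frontier \<Omega> \<Longrightarrow> V y \<bullet> n y = 0"
    and q: "q \<le> r / 2" and small: "\<And>y. y \<in> cball x q \<Longrightarrow> \<bar>\<rho> y\<bar> < r / 2"
    and supp: "\<And>y. y \<in> \<Omega> \<Longrightarrow> y \<notin> cball x q \<Longrightarrow> V y = 0"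
  shows "has_bochner_integral lborel (\<lambda>y. indicator \<Omega> y * trace (A y)) 0"
proof -
  have qr: "q < r" using q r_pos by simp
  have Vc: "continuous_on (closure \<Omega>) V" and Ac: "continuous_on (closure \<Omega>) A"
    using V by (auto simp: C1_closure_field_def)
  have cpt: "compact (closure \<Omega>)" using \<open>bounded \<Omega>\<close> by simp
  define E where "E m = 1 / real (Suc m)" for m
  have E: "E m > 0" for m by (simp add: E_def)
  define B where "B m y = cutoff (E m) y *\<^sub>R A y + outer_product (V y) (cutoff_slope (E m) y *\<^sub>R n y)" for m y
  have trB: "trace (B m y) = cutoff (E m) y * trace (A y) + cutoff_slope (E m) y * (V y \<bullet> n y)" for m y
    by (simp add: B_def trace_add trace_scaleR trace_outer_product)
  define s where "s m y = trace (if y \<in> \<Omega> then B m y else 0)" for m y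
  have s0: "has_bochner_integral lborel (s m) 0" for m
  proof -
    have pos: "(E m)\<^sup>2 + (\<rho> y)\<^sup>2 > 0" for y using E[of m] by (simp add: add_pos_nonneg)
    have "continuous_on (closure \<Omega>) (B m)"
      unfolding B_def cutoff_def cutoff_slope_def
      by (intro continuous_intros Vc Ac n_cont \<rho>_cont) (use pos in \<open>auto simp: less_le\<close>)
    then obtain C where "C \<ge> 0" and C: "\<And>y. y \<in> closure \<Omega> \<Longrightarrow> norm (B m y) \<le> C"
      using continuous_on_compact_bound cpt by metis
    show ?thesis
      unfolding s_def
    proof (rule integral_trace_derivative_eq_0[OF \<open>bounded \<Omega>\<close>])
      show "((\<lambda>y. if y \<in> \<Omega> then cutoff (E m) y *\<^sub>R V y else 0) has_derivative (\<lambda>v. (if y \<in> \<Omega> then B m y else 0) *v v)) (at y)" for y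
        unfolding B_def by (rule cutoff_extension_has_derivative[OF E V \<open>bounded \<Omega>\<close> qr supp])
      show "norm (if y \<in> \<Omega> then B m y else 0) \<le> C" for y
        using C \<open>C \<ge> 0\<close> closure_subset[of \<Omega>] by auto
    qed auto
  qed
  obtain C1 where C1: "C1 \<ge> 0" "\<And>y. y \<in> closure \<Omega> \<Longrightarrow> norm (trace (A y)) \<le> C1"
    using continuous_on_compact_bound[OF cpt continuous_on_trace[OF Ac]] by metis
  obtain C2 where C2: "C2 \<ge> 0" "\<And>y. y \<in> \<Omega> \<Longrightarrow> y \<in> cball x q \<Longrightarrow> \<bar>V y \<bullet> n y\<bar> \<le> C2 * \<rho> y"
    using inner_n_le_\<rho>[OF \<open>bounded \<Omega>\<close> V tang q small] by metis
  have A0: "A y = 0" if "y \<in> \<Omega>" "y \<notin> cball x q" for y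
    by (rule C1_closure_field_vanishing[OF V, of "\<Omega> - cball x q"]) (use that supp open_\<Omega> in auto)
  have \<rho>pos: "\<rho> y > 0" if "y \<in> \<Omega>" "y \<in> cball x q" for y
    using in_\<Omega>_iff[of y] that qr by auto
  have lim: "(\<lambda>m. s m y) \<longlonglongrightarrow> indicator \<Omega> y * trace (A y)" for y
  proof (cases "y \<in> \<Omega>")
    case True
    show ?thesis
    proof (cases "y \<in> cball x q")
      case c: True
      have "(\<lambda>m. cutoff (E m) y * trace (A y) + cutoff_slope (E m) y * (V y \<bullet> n y)) \<longlonglongrightarrow> 1 * trace (A y) + 0 * (V y \<bullet> n y)"
        unfolding E_def by (intro tendsto_intros cutoff_tendsto \<rho>pos[OF True c])
      then show ?thesis using True by (simp add: s_def trB)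
    next
      case False
      then show ?thesis using True A0 supp by (simp add: s_def trB trace_zero)
    qed
  qed (simp add: s_def trace_zero)
  \<comment> \<open>\<open>C1\<close> bounds the divergence term and \<open>C2\<close> the term with the gradient of the cutoff\<close>
  define w where "w y = (C1 + C2) * indicator (closure \<Omega>) y" for y
  have dom: "norm (s m y) \<le> w y" for m y
  proof (cases "y \<in> \<Omega>")
    case True
    have "cutoff (E m) y \<ge> 0" "cutoff (E m) y \<le> 1"
      using E[of m] by (auto simp: cutoff_def divide_le_eq_1 add_pos_nonneg)
    moreover have "\<bar>trace (A y)\<bar> \<le> C1" using C1 True closure_subset[of \<Omega>] by auto
    ultimately have "\<bar>cutoff (E m) y * trace (A y)\<bar> \<le> 1 * C1"
      unfolding abs_mult by (intro mult_mono) auto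
    moreover have "\<bar>cutoff_slope (E m) y * (V y \<bullet> n y)\<bar> \<le> C2"
      by (cases "y \<in> cball x q") (use C2 True \<rho>pos cutoff_slope_bound[OF E] supp in auto)
    ultimately show ?thesis
      using True closure_subset[of \<Omega>] by (auto simp: s_def trB w_def indicator_def)
  next
    case False
    then show ?thesis using C1(1) C2(1) by (simp add: s_def w_def trace_zero)
  qed
  have wint: "integrable lborel w"
    using borel_integrable_compact[OF cpt continuous_on_const, of "C1 + C2"]
    by (simp add: w_def[abs_def] mult.commute)
  have sm: "s m \<in> borel_measurable lborel" for m using s0 has_bochner_integral_iff by blast
  have m': "(\<lambda>y. indicator \<Omega> y * trace (A y)) \<in> borel_measurable lborel"
    using lim sm by (rule borel_measurable_LIMSEQ_real)
  have "integrable lborel (\<lambda>y. indicator \<Omega> y * trace (A y))"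
    by (rule integrable_dominated_convergence[where s=s and w=w]) (use m' sm wint lim dom in auto)
  moreover have "(\<lambda>m. integral\<^sup>L lborel (s m)) \<longlonglongrightarrow> (\<integral>y. indicator \<Omega> y * trace (A y) \<partial>lborel)"
    by (rule integral_dominated_convergence[where w=w]) (use m' sm wint lim dom in auto)
  then have "(\<integral>y. indicator \<Omega> y * trace (A y) \<partial>lborel) = 0"
    using s0 by (simp add: has_bochner_integral_iff LIMSEQ_const_iff)
  ultimately show ?thesis by (simp add: has_bochner_integral_iff)
qed

end

lemma integral_divergence_compact_support:
  assumes "open \<Omega>" "bounded \<Omega>" and V: "C1_closure_field \<Omega> V A"
    and sub: "cball x q \<subseteq> \<Omega>" and supp: "\<And>y. y \<in> \<Omega> \<Longrightarrow> y \<notin> cball x q \<Longrightarrow> V y = 0"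
  shows "has_bochner_integral lborel (\<lambda>y. indicator \<Omega> y * trace (A y)) 0"
proof -
  have Ac: "continuous_on (closure \<Omega>) A" using V by (auto simp: C1_closure_field_def)
  obtain C where "C \<ge> 0" and C: "\<And>y. y \<in> closure \<Omega> \<Longrightarrow> norm (A y) \<le> C"
    using continuous_on_compact_bound[OF _ Ac] \<open>bounded \<Omega>\<close> compact_closure by metis
  have "has_bochner_integral lborel (\<lambda>y. trace (if y \<in> \<Omega> then A y else 0)) 0"
  proof (rule integral_trace_derivative_eq_0[OF \<open>bounded \<Omega>\<close>])
    show "((\<lambda>y. if y \<in> \<Omega> then V y else 0) has_derivative (\<lambda>v. (if y \<in> \<Omega> then A y else 0) *v v)) (at y)" for y
    proof (cases "y \<in> \<Omega>")
      case True
      then have "(V has_derivative (\<lambda>v. A y *v v)) (at y)" using V by (simp add: C1_closure_field_def)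
      then have "((\<lambda>y. if y \<in> \<Omega> then V y else 0) has_derivative (\<lambda>v. A y *v v)) (at y)"
        by (rule has_derivative_transform_within_open[OF _ \<open>open \<Omega>\<close> True]) simp
      then show ?thesis using True by simp
    next
      case False
      then have "((\<lambda>y. if y \<in> \<Omega> then V y else 0) has_derivative (\<lambda>_. 0)) (at y)"
        using sub supp by (intro has_derivative_0_of_vanishing[of "- cball x q"]) auto
      then show ?thesis using False by simp
    qed
    show "norm (if y \<in> \<Omega> then A y else 0) \<le> C" for y
      using C \<open>C \<ge> 0\<close> closure_subset[of \<Omega>] by auto
  qed auto
  moreover have "(\<lambda>y. trace (if y \<in> \<Omega> then A y else 0)) = (\<lambda>y. indicator \<Omega> y * trace (A y))"
    by (auto simp: fun_eq_iff trace_zero)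
  ultimately show ?thesis by simp
qed

text \<open>
  The divergence theorem for tangential fields supported in one ball. As this says nothing about how the ball lies,
  interior balls and balls around boundary points can be glued alike.
\<close>
definition divergence_ball :: "(real ^ 'd::finite) set \<Rightarrow> (real ^ 'd \<Rightarrow> real ^ 'd) \<Rightarrow> real ^ 'd \<Rightarrow> real \<Rightarrow> bool" where
  "divergence_ball \<Omega> \<nu> x q \<longleftrightarrow> q > 0 \<and>
     (\<forall>V A. C1_closure_field \<Omega> V A \<longrightarrow> (\<forall>z\<in>frontier \<Omega>. V z \<bullet> \<nu> z = 0) \<longrightarrow>
        (\<forall>y\<in>\<Omega>. y \<notin> cball x q \<longrightarrow> V y = 0) \<longrightarrow>
        has_bochner_integral lborel (\<lambda>y. indicator \<Omega> y * trace (A y)) 0)"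

lemma divergence_ball_exists:
  assumes "open \<Omega>" "bounded \<Omega>" "smooth_boundary \<Omega>"
    and normal: "\<And>z. z \<in> frontier \<Omega> \<Longrightarrow> outer_unit_normal_at \<Omega> z (\<nu> z)"
    and x: "x \<in> closure \<Omega>"
  shows "\<exists>q. divergence_ball \<Omega> \<nu> x q"
proof (cases "x \<in> \<Omega>")
  case True
  then obtain q where "q > 0" "cball x q \<subseteq> \<Omega>" using \<open>open \<Omega>\<close> open_contains_cball by blast
  then show ?thesis
    unfolding divergence_ball_def using integral_divergence_compact_support[OF assms(1,2)] by blast
next
  case False
  then have fr: "x \<in> frontier \<Omega>" using x \<open>open \<Omega>\<close> by (simp add: frontier_open_iff)
  obtain r e \<rho> n M where "boundary_chart \<Omega> x r e \<rho> n M"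
    by (rule smooth_boundary_chart[OF assms(1,3) fr])
  then interpret boundary_chart \<Omega> x r e \<rho> n M .
  have "\<rho> x = 0" using frontier_iff[of x] fr r_pos by simp
  moreover have "isCont \<rho> x" using \<rho>_cont[of UNIV] by (simp add: continuous_on_eq_continuous_at)
  ultimately obtain d where "d > 0" and d: "\<And>y. dist y x < d \<Longrightarrow> \<bar>\<rho> y\<bar> < r/2"
    using half_gt_zero[OF r_pos] unfolding continuous_at_eps_delta by (metis diff_zero dist_real_def)
  \<comment> \<open>Points of this closed ball stay in the chart when they are projected to the boundary along \<open>e\<close>\<close>
  define q where "q = min (d/2) (r/2)"
  have q: "q > 0" "q \<le> r/2" and small: "\<And>y. y \<in> cball x q \<Longrightarrow> \<bar>\<rho> y\<bar> < r/2"
    using \<open>d > 0\<close> r_pos d by (auto simp: q_def dist_commute simp del: less_divide_eq_numeral1)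
  have "has_bochner_integral lborel (\<lambda>y. indicator \<Omega> y * trace (A y)) 0"
    if V: "C1_closure_field \<Omega> V A" and tang: "\<forall>z\<in>frontier \<Omega>. V z \<bullet> \<nu> z = 0"
      and supp: "\<forall>y\<in>\<Omega>. y \<notin> cball x q \<longrightarrow> V y = 0" for V A
  proof (rule integral_divergence_near_boundary[OF \<open>bounded \<Omega>\<close> V _ q(2) small])
    fix z assume z: "z \<in> ball x r" "z \<in> frontier \<Omega>"
    have "\<rho> z = 0" using frontier_iff z by blast
    from normal_parallel[OF z(1) this normal[OF z(2)]] obtain c where "c \<noteq> 0" "\<nu> z = c *\<^sub>R n z" .
    then show "V z \<bullet> n z = 0" using tang z(2) by auto
  qed (use supp in auto)
  then show ?thesis unfolding divergence_ball_def using q(1) by blast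
qed

lemma has_real_derivative_max_0_square: "((\<lambda>t::real. (max 0 t)\<^sup>2) has_real_derivative 2 * max 0 t) (at t)"
proof -
  consider "t < 0" | "t = 0" | "t > 0" by linarith
  then show ?thesis
  proof cases
    case 1
    have "((\<lambda>t::real. 0) has_real_derivative 0) (at t)" by simp
    then have "((\<lambda>t::real. (max 0 t)\<^sup>2) has_real_derivative 0) (at t)"
      by (rule has_field_derivative_transform_within_open[of _ _ _ "{..<0}"]) (use 1 in auto)
    then show ?thesis using 1 by simp
  next
    case 2
    have "((\<lambda>t::real. (max 0 t)\<^sup>2) has_derivative (\<lambda>_. 0)) (at 0)"
    proof (rule has_derivative_0_comparison[where g="\<lambda>t. t\<^sup>2" and C=1])
      show "((\<lambda>t::real. t\<^sup>2) has_derivative (\<lambda>_. 0)) (at 0)" by (auto intro!: derivative_eq_intros)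
    qed (auto simp: max_def)
    then show ?thesis using 2 by (simp add: has_field_derivative_def lambda_zero)
  next
    case 3
    have "((\<lambda>t::real. t\<^sup>2) has_real_derivative 2 * t) (at t)" by (auto intro!: derivative_eq_intros)
    then have "((\<lambda>t::real. (max 0 t)\<^sup>2) has_real_derivative 2 * t) (at t)"
      by (rule has_field_derivative_transform_within_open[of _ _ _ "{0<..}"]) (use 3 in auto)
    then show ?thesis using 3 by simp
  qed
qed

text \<open>
  Squaring the positive part makes it continuously differentiable.
\<close>
definition bump :: "'a::real_inner \<Rightarrow> real \<Rightarrow> 'a \<Rightarrow> real" where
  "bump c q y = (max 0 (q\<^sup>2 - (y - c) \<bullet> (y - c)))\<^sup>2"

definition bump_grad :: "'a::real_inner \<Rightarrow> real \<Rightarrow> 'a \<Rightarrow> 'a" where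
  "bump_grad c q y = (- 4 * max 0 (q\<^sup>2 - (y - c) \<bullet> (y - c))) *\<^sub>R (y - c)"

lemma bump_has_derivative: "(bump c q has_derivative (\<lambda>v. bump_grad c q y \<bullet> v)) (at y)"
proof -
  have "((\<lambda>y. q\<^sup>2 - (y - c) \<bullet> (y - c)) has_derivative (\<lambda>v. - 2 * ((y - c) \<bullet> v))) (at y)"
    by (auto intro!: derivative_eq_intros simp: inner_commute)
  from has_derivative_compose[OF this has_real_derivative_max_0_square[unfolded has_field_derivative_def]]
  show ?thesis unfolding bump_def[abs_def] bump_grad_def by (simp add: algebra_simps)
qed

lemma bump_continuous: "continuous_on S (bump c q)" "continuous_on S (bump_grad c q)"
  unfolding bump_def[abs_def] bump_grad_def[abs_def] by (intro continuous_intros)+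

lemma bump_pos_iff:
  assumes "q > 0"
  shows "bump c q y > 0 \<longleftrightarrow> y \<in> ball c q"
proof -
  have "bump c q y > 0 \<longleftrightarrow> (y - c) \<bullet> (y - c) < q\<^sup>2"
    by (auto simp: bump_def zero_less_power2 max_def)
  also have "\<dots> \<longleftrightarrow> norm (y - c) < q"
    using assms power2_less_imp_less[of "norm (y - c)" q] power_strict_mono[of "norm (y - c)" q 2]
    by (auto simp: power2_norm_eq_inner[symmetric])
  finally show ?thesis by (simp add: dist_norm norm_minus_commute)
qed

lemma bump_nonneg: "bump c q y \<ge> 0"
  by (simp add: bump_def)

text \<open>
  Gluing of the local statements: the closure is covered by finitely many balls, the bump functions of
  these balls are divided by their sum \<open>H\<close>, and the divergences of the pieces add up to that of \<open>V\<close> since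
  the gradients of a partition of unity sum to zero.
\<close>
theorem integral_divergence_tangential_eq_0:
  assumes "open \<Omega>" "bounded \<Omega>" "smooth_boundary \<Omega>"
    and normal: "\<And>z. z \<in> frontier \<Omega> \<Longrightarrow> outer_unit_normal_at \<Omega> z (\<nu> z)"
    and V: "C1_closure_field \<Omega> V A" and tang: "\<And>z. z \<in> frontier \<Omega> \<Longrightarrow> V z \<bullet> \<nu> z = 0"
  shows "has_bochner_integral lborel (\<lambda>y. indicator \<Omega> y * trace (A y)) 0"
proof -
  obtain R where R: "\<And>x. x \<in> closure \<Omega> \<Longrightarrow> divergence_ball \<Omega> \<nu> x (R x)"
    using divergence_ball_exists[OF assms(1-4)] by metis
  have R_pos: "R x > 0" if "x \<in> closure \<Omega>" for x using R[OF that] by (simp add: divergence_ball_def)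
  have cpt: "compact (closure \<Omega>)" using \<open>bounded \<Omega>\<close> by simp
  have cov: "closure \<Omega> \<subseteq> (\<Union>c\<in>closure \<Omega>. ball c (R c))" using R_pos by force
  obtain C where C: "C \<subseteq> closure \<Omega>" "finite C" and cover: "closure \<Omega> \<subseteq> (\<Union>c\<in>C. ball c (R c))"
    by (rule compactE_image[OF cpt open_ball cov])
  define H where "H y = (\<Sum>c\<in>C. bump c (R c) y)" for y
  define dH where "dH y = (\<Sum>c\<in>C. bump_grad c (R c) y)" for y
  have H_pos: "H y > 0" if y: "y \<in> closure \<Omega>" for y
  proof -
    obtain c where "c \<in> C" "y \<in> ball c (R c)" using cover y by blast
    then show ?thesis unfolding H_def using C R_pos
      by (intro sum_pos2[of _ c]) (auto simp: bump_nonneg bump_pos_iff simp del: mem_ball)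
  qed
  have H_deriv: "(H has_derivative (\<lambda>v. dH y \<bullet> v)) (at y)" for y
    unfolding H_def[abs_def] dH_def inner_sum_left by (intro has_derivative_sum bump_has_derivative)
  have H_cont: "continuous_on S H" "continuous_on S dH" for S
    unfolding H_def[abs_def] dH_def[abs_def] by (intro continuous_on_sum bump_continuous)+
  define f where "f c y = bump c (R c) y / H y" for c y
  \<comment> \<open>The gradient of \<open>f c\<close> by the quotient rule\<close>
  define g where "g c y = (1 / H y) *\<^sub>R bump_grad c (R c) y - (bump c (R c) y / (H y)\<^sup>2) *\<^sub>R dH y" for c y
  have int: "has_bochner_integral lborel (\<lambda>y. indicator \<Omega> y * trace (f c y *\<^sub>R A y + outer_product (V y) (g c y))) 0"
    if c: "c \<in> C" for c
  proof -
    have "C1_closure_field \<Omega> (\<lambda>y. f c y *\<^sub>R V y) (\<lambda>y. f c y *\<^sub>R A y + outer_product (V y) (g c y))"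
    proof (rule C1_closure_field_scaleR[OF V])
      show "continuous_on (closure \<Omega>) (f c)" "continuous_on (closure \<Omega>) (g c)"
        unfolding f_def g_def by (intro continuous_intros bump_continuous H_cont; use H_pos in force)+
      fix y assume "y \<in> \<Omega>"
      then have "H y > 0" using H_pos closure_subset by blast
      then show "(f c has_derivative (\<lambda>v. g c y \<bullet> v)) (at y)"
        unfolding f_def
        by (auto intro!: derivative_eq_intros bump_has_derivative H_deriv
            simp: g_def inner_diff_left power2_eq_square field_simps)
    qed
    moreover have "\<forall>z\<in>frontier \<Omega>. (f c z *\<^sub>R V z) \<bullet> \<nu> z = 0" using tang by simp
    moreover have "f c y *\<^sub>R V y = 0" if "y \<notin> cball c (R c)" for y
    proof -
      have "y \<notin> ball c (R c)" using that by auto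
      then have "bump c (R c) y = 0"
        using bump_pos_iff[of "R c" c y] R_pos C c bump_nonneg[of c "R c" y] by (auto simp: less_le)
      then show ?thesis by (simp add: f_def)
    qed
    ultimately show ?thesis
      using R[of c] c C unfolding divergence_ball_def by blast
  qed
  have "has_bochner_integral lborel
    (\<lambda>y. \<Sum>c\<in>C. indicator \<Omega> y * trace (f c y *\<^sub>R A y + outer_product (V y) (g c y))) (\<Sum>c\<in>C. 0)"
    using int by (rule has_bochner_integral_sum)
  moreover have "(\<Sum>c\<in>C. indicator \<Omega> y * trace (f c y *\<^sub>R A y + outer_product (V y) (g c y)))
    = indicator \<Omega> y * trace (A y)" for y
  proof (cases "y \<in> \<Omega>")
    case True
    then have "H y > 0" using H_pos closure_subset by blast
    have "(\<Sum>c\<in>C. f c y) = 1"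
      using \<open>H y > 0\<close> by (simp add: f_def sum_divide_distrib[symmetric] H_def[symmetric])
    moreover have "(\<Sum>c\<in>C. g c y) = 0"
      using \<open>H y > 0\<close>
      by (simp add: g_def sum_subtractf scaleR_right.sum[symmetric] scaleR_left.sum[symmetric]
          sum_divide_distrib[symmetric] H_def[symmetric] dH_def[symmetric] power2_eq_square)
    ultimately have "(\<Sum>c\<in>C. trace (f c y *\<^sub>R A y + outer_product (V y) (g c y))) = trace (A y)"
      by (simp add: trace_add trace_scaleR trace_outer_product sum.distrib sum_distrib_right[symmetric]
          inner_sum_right[symmetric])
    then show ?thesis by (simp add: sum_distrib_left[symmetric])
  qed simp
  ultimately show ?thesis by simp
qed

section \<open>Gradients of inner products up to the boundary\<close>

lemma pd_inner:
  assumes V: "C1_closure_field \<Omega> V A" and W: "C1_closure_field \<Omega> W B" and y: "y \<in> \<Omega>"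
  shows "pd \<Omega> j (\<lambda>z. V z \<bullet> W z) y = (A y *v axis j 1) \<bullet> W y + V y \<bullet> (B y *v axis j 1)"
proof -
  have "(V has_derivative (\<lambda>v. A y *v v)) (at y)" "(W has_derivative (\<lambda>v. B y *v v)) (at y)"
    using V W y by (auto simp: C1_closure_field_def)
  from has_derivative_inner[OF this]
  show ?thesis by (subst pd_eq_derivative[OF y]) (auto simp: add.commute)
qed

text \<open>
  At a boundary point \<open>pd\<close> is a limit of interior values, so a formula with continuous right-hand side extends from \<open>\<Omega>\<close>
  to its closure.
\<close>
lemma pd_closure_eqI:
  assumes "open \<Omega>" and x: "x \<in> closure \<Omega>" and g: "continuous_on (closure \<Omega>) g"
    and eq: "\<And>y. y \<in> \<Omega> \<Longrightarrow> pd \<Omega> j f y = g y"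
  shows "pd \<Omega> j f x = g x"
proof (cases "x \<in> \<Omega>")
  case False
  define D where "D y = deriv (\<lambda>t::real. f (y + t *\<^sub>R axis j 1)) 0" for y
  have D: "D y = g y" if "y \<in> \<Omega>" for y using eq[OF that] that by (simp add: pd_def D_def)
  have "(g \<longlongrightarrow> g x) (at x within closure \<Omega>)"
    using g x unfolding continuous_on_def by blast
  then have "(g \<longlongrightarrow> g x) (at x within \<Omega>)"
    by (rule tendsto_within_subset[OF _ closure_subset])
  moreover have "\<forall>\<^sub>F y in at x within \<Omega>. g y = D y"
    unfolding eventually_at_filter by (rule always_eventually) (simp add: D)
  ultimately have "(D \<longlongrightarrow> g x) (at x within \<Omega>)"
    by (rule Lim_transform_eventually)
  moreover have "at x within \<Omega> \<noteq> bot"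
    using x False unfolding trivial_limit_within closure_def by blast
  ultimately have "Lim (at x within \<Omega>) D = g x" using tendsto_Lim by blast
  then show ?thesis using False by (simp add: pd_def D_def[abs_def] Let_def)
qed (rule eq)

lemma inner_transpose: "(transpose B *v v) \<bullet> w = v \<bullet> (B *v w)" for B :: "real ^ 'n::finite ^ 'm::finite"
  by (simp add: dot_lmul_matrix)

lemma grad_inner_fields:
  assumes "open \<Omega>" and V: "C1_closure_field \<Omega> V A" and W: "C1_closure_field \<Omega> W B" and x: "x \<in> closure \<Omega>"
  shows "grad \<Omega> (\<lambda>z. V z \<bullet> W z) x \<bullet> w = (A x *v w) \<bullet> W x + V x \<bullet> (B x *v w)"
proof -
  have c: "continuous_on (closure \<Omega>) V" "continuous_on (closure \<Omega>) W" "continuous_on (closure \<Omega>) A" "continuous_on (closure \<Omega>) B"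
    using V W by (auto simp: C1_closure_field_def)
  have "pd \<Omega> j (\<lambda>z. V z \<bullet> W z) x = (A x *v axis j 1) \<bullet> W x + V x \<bullet> (B x *v axis j 1)" for j
    by (rule pd_closure_eqI[OF assms(1) x _ pd_inner[OF V W]]) (intro continuous_intros c)
  then have "grad \<Omega> (\<lambda>z. V z \<bullet> W z) x = transpose (A x) *v W x + transpose (B x) *v V x"
    by (simp add: grad_def vec_eq_iff matrix_vector_mul_component inner_axis inner_commute
        matrix_vector_mult_def transpose_def inner_vec_def axis_def if_distrib mult.commute cong: if_cong)
  then show ?thesis
    by (simp only: inner_add_left inner_transpose inner_commute[of "W x"])
qed

section \<open>Rigidity: the symmetrised Jacobian vanishes\<close>

definition sym_jacobian :: "(real ^ 'd::finite) set \<Rightarrow> (real ^ 'd \<Rightarrow> real ^ 'd) \<Rightarrow> real ^ 'd \<Rightarrow> real ^ 'd ^ 'd" where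
  "sym_jacobian \<Omega> V y = jacobian \<Omega> V y + transpose (jacobian \<Omega> V y)"

lemma sym_jacobian_nth:
  "sym_jacobian \<Omega> V y $ i $ j = pd \<Omega> j (\<lambda>z. V z $ i) y + pd \<Omega> i (\<lambda>z. V z $ j) y"
  by (simp add: sym_jacobian_def jacobian_def transpose_def)

text \<open>
  The Jacobian of \<open>S V\<close>, where \<open>S\<close> is the symmetrised Jacobian of \<open>V\<close>, by the product rule.
\<close>
definition sym_jacobian_image_deriv ::
    "(real ^ 'd::finite) set \<Rightarrow> (real ^ 'd \<Rightarrow> real ^ 'd) \<Rightarrow> real ^ 'd \<Rightarrow> real ^ 'd ^ 'd" where
  "sym_jacobian_image_deriv \<Omega> V y = (\<chi> i k. \<Sum>l\<in>UNIV.
      (pd \<Omega> k (pd \<Omega> l (\<lambda>z. V z $ i)) y + pd \<Omega> k (pd \<Omega> i (\<lambda>z. V z $ l)) y) * V y $ l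
      + sym_jacobian \<Omega> V y $ i $ l * pd \<Omega> k (\<lambda>z. V z $ l) y)"

lemma C1_closure_field_sym_jacobian_image:
  assumes "open \<Omega>" and V: "vec_Ck_closure 2 \<Omega> V"
  shows "C1_closure_field \<Omega> (\<lambda>y. sym_jacobian \<Omega> V y *v V y) (sym_jacobian_image_deriv \<Omega> V)"
  unfolding C1_closure_field_def
proof (intro conjI ballI)
  have C2: "Ck_closure (Suc (Suc 0)) \<Omega> (\<lambda>z. V z $ i)" for i
    using V by (simp add: vec_Ck_closure_def numeral_2_eq_2)
  then have C1: "Ck_closure (Suc 0) \<Omega> (pd \<Omega> l (\<lambda>z. V z $ i))" for i l by simp
  have c0: "continuous_on (closure \<Omega>) (\<lambda>z. V z $ i)" for i using C2 by (rule Ck_closure_continuous)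
  have c1: "continuous_on (closure \<Omega>) (pd \<Omega> l (\<lambda>z. V z $ i))" for i l using C1 by (rule Ck_closure_continuous)
  have c2: "continuous_on (closure \<Omega>) (pd \<Omega> k (pd \<Omega> l (\<lambda>z. V z $ i)))" for i k l
    using C1 by (simp add: Ck_closure_continuous)
  show "continuous_on (closure \<Omega>) (\<lambda>y. sym_jacobian \<Omega> V y *v V y)"
    unfolding matrix_vector_mult_def sym_jacobian_nth by (intro continuous_intros c0 c1)
  show "continuous_on (closure \<Omega>) (sym_jacobian_image_deriv \<Omega> V)"
    unfolding sym_jacobian_image_deriv_def[abs_def] sym_jacobian_nth by (intro continuous_intros c0 c1 c2)
  fix y assume y: "y \<in> \<Omega>"
  have d0: "((\<lambda>z. V z $ i) has_derivative (\<lambda>v. \<Sum>k\<in>UNIV. pd \<Omega> k (\<lambda>z. V z $ i) y * v $ k)) (at y)" for i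
    using Ck_closure_has_derivative[OF assms(1) C2 y] by (simp add: grad_def inner_vec_def)
  have d1: "(pd \<Omega> l (\<lambda>z. V z $ i) has_derivative (\<lambda>v. \<Sum>k\<in>UNIV. pd \<Omega> k (pd \<Omega> l (\<lambda>z. V z $ i)) y * v $ k)) (at y)" for i l
    using Ck_closure_has_derivative[OF assms(1) C1 y] by (simp add: grad_def inner_vec_def)
  show "((\<lambda>y. sym_jacobian \<Omega> V y *v V y) has_derivative (\<lambda>v. sym_jacobian_image_deriv \<Omega> V y *v v)) (at y)"
  proof (rule has_derivative_vecI)
    fix i
    have "((\<lambda>y. \<Sum>l\<in>UNIV. sym_jacobian \<Omega> V y $ i $ l * V y $ l) has_derivative
      (\<lambda>v. \<Sum>l\<in>UNIV. sym_jacobian \<Omega> V y $ i $ l * (\<Sum>k\<in>UNIV. pd \<Omega> k (\<lambda>z. V z $ l) y * v $ k)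
        + ((\<Sum>k\<in>UNIV. pd \<Omega> k (pd \<Omega> l (\<lambda>z. V z $ i)) y * v $ k)
           + (\<Sum>k\<in>UNIV. pd \<Omega> k (pd \<Omega> i (\<lambda>z. V z $ l)) y * v $ k)) * V y $ l)) (at y)"
      unfolding sym_jacobian_nth by (intro has_derivative_sum has_derivative_mult has_derivative_add d0 d1)
    moreover have "(\<Sum>l\<in>UNIV. sym_jacobian \<Omega> V y $ i $ l * (\<Sum>k\<in>UNIV. pd \<Omega> k (\<lambda>z. V z $ l) y * v $ k)
        + ((\<Sum>k\<in>UNIV. pd \<Omega> k (pd \<Omega> l (\<lambda>z. V z $ i)) y * v $ k)
           + (\<Sum>k\<in>UNIV. pd \<Omega> k (pd \<Omega> i (\<lambda>z. V z $ l)) y * v $ k)) * V y $ l)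
      = (sym_jacobian_image_deriv \<Omega> V y *v v) $ i" for v
    proof -
      have "(sym_jacobian_image_deriv \<Omega> V y *v v) $ i = (\<Sum>k\<in>UNIV. \<Sum>l\<in>UNIV.
          ((pd \<Omega> k (pd \<Omega> l (\<lambda>z. V z $ i)) y + pd \<Omega> k (pd \<Omega> i (\<lambda>z. V z $ l)) y) * V y $ l
          + sym_jacobian \<Omega> V y $ i $ l * pd \<Omega> k (\<lambda>z. V z $ l) y) * v $ k)"
        by (simp add: sym_jacobian_image_deriv_def matrix_vector_mult_def sum_distrib_right)
      also have "\<dots> = (\<Sum>l\<in>UNIV. \<Sum>k\<in>UNIV.
          ((pd \<Omega> k (pd \<Omega> l (\<lambda>z. V z $ i)) y + pd \<Omega> k (pd \<Omega> i (\<lambda>z. V z $ l)) y) * V y $ l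
          + sym_jacobian \<Omega> V y $ i $ l * pd \<Omega> k (\<lambda>z. V z $ l) y) * v $ k)"
        by (rule sum.swap)
      finally show ?thesis
        by (simp add: sum_distrib_left sum_distrib_right sum.distrib algebra_simps)
    qed
    ultimately show "((\<lambda>y. (sym_jacobian \<Omega> V y *v V y) $ i) has_derivative
        (\<lambda>v. (sym_jacobian_image_deriv \<Omega> V y *v v) $ i)) (at y)"
      by (simp add: matrix_vector_mult_def[of "sym_jacobian \<Omega> V _"])
  qed
qed

text \<open>
  This is \<open>div (S V) = \<langle>\<nabla> (div V), V\<rangle> + \<langle>\<Delta>V, V\<rangle> + |S|\<^sup>2/2\<close>. The first term comes from commuting
  derivatives, the last one from symmetrising \<open>\<Sum> S\<^sub>i\<^sub>l \<partial>\<^sub>i V\<^sub>l\<close>.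
\<close>
lemma trace_sym_jacobian_image_deriv:
  assumes "open \<Omega>" and V: "vec_Ck_closure 2 \<Omega> V" and y: "y \<in> \<Omega>"
    and div: "\<And>z. z \<in> \<Omega> \<Longrightarrow> divergence \<Omega> V z = 0"
    and lap: "vec_laplacian \<Omega> V y \<bullet> V y = 0"
  shows "trace (sym_jacobian_image_deriv \<Omega> V y) = (\<Sum>i\<in>UNIV. \<Sum>l\<in>UNIV. (sym_jacobian \<Omega> V y $ i $ l)\<^sup>2) / 2"
proof -
  have C2: "Ck_closure (Suc (Suc 0)) \<Omega> (\<lambda>z. V z $ i)" for i
    using V by (simp add: vec_Ck_closure_def numeral_2_eq_2)
  then have C1: "Ck_closure (Suc 0) \<Omega> (pd \<Omega> l (\<lambda>z. V z $ i))" for i l by simp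
  define S where "S i l = sym_jacobian \<Omega> V y $ i $ l" for i l
  have Ssym: "S i l = S l i" for i l by (simp add: S_def sym_jacobian_nth)
  \<comment> \<open>Commuting derivatives turns this into the \<open>l\<close>-th derivative of the divergence\<close>
  have graddiv: "(\<Sum>i\<in>UNIV. pd \<Omega> i (pd \<Omega> l (\<lambda>z. V z $ i)) y) = 0" for l
  proof -
    have "(\<Sum>i\<in>UNIV. pd \<Omega> i (pd \<Omega> l (\<lambda>z. V z $ i)) y) = (\<Sum>i\<in>UNIV. pd \<Omega> l (pd \<Omega> i (\<lambda>z. V z $ i)) y)"
      using Ck_closure_pd_commute[OF assms(1) C2] y closure_subset by (intro sum.cong) blast+
    also have "\<dots> = (\<Sum>i\<in>UNIV. grad \<Omega> (pd \<Omega> i (\<lambda>z. V z $ i)) y \<bullet> axis l 1)"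
      by (simp add: grad_def inner_axis)
    also have "\<dots> = pd \<Omega> l (divergence \<Omega> V) y"
      unfolding divergence_def[abs_def]
      by (rule pd_eq_derivative[OF y, symmetric]) (intro has_derivative_sum Ck_closure_has_derivative[OF assms(1) C1 y])
    also have "\<dots> = 0"
      by (rule pd_eq_derivative[OF y]) (rule has_derivative_0_of_vanishing[OF assms(1) y div])
    finally show ?thesis .
  qed
  have "trace (sym_jacobian_image_deriv \<Omega> V y) =
      (\<Sum>i\<in>UNIV. \<Sum>l\<in>UNIV. pd \<Omega> i (pd \<Omega> l (\<lambda>z. V z $ i)) y * V y $ l)
      + (\<Sum>i\<in>UNIV. \<Sum>l\<in>UNIV. pd \<Omega> i (pd \<Omega> i (\<lambda>z. V z $ l)) y * V y $ l)
      + (\<Sum>i\<in>UNIV. \<Sum>l\<in>UNIV. S i l * pd \<Omega> i (\<lambda>z. V z $ l) y)"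
    by (simp add: trace_def sym_jacobian_image_deriv_def S_def sum.distrib distrib_right)
  moreover have "(\<Sum>i\<in>UNIV. \<Sum>l\<in>UNIV. pd \<Omega> i (pd \<Omega> l (\<lambda>z. V z $ i)) y * V y $ l) = 0"
    by (subst sum.swap) (simp add: sum_distrib_right[symmetric] graddiv)
  moreover have "(\<Sum>i\<in>UNIV. \<Sum>l\<in>UNIV. pd \<Omega> i (pd \<Omega> i (\<lambda>z. V z $ l)) y * V y $ l) = vec_laplacian \<Omega> V y \<bullet> V y"
    by (subst sum.swap) (simp add: sum_distrib_right[symmetric] vec_laplacian_def laplacian_def inner_vec_def)
  moreover have "(\<Sum>i\<in>UNIV. \<Sum>l\<in>UNIV. S i l * pd \<Omega> i (\<lambda>z. V z $ l) y) = (\<Sum>i\<in>UNIV. \<Sum>l\<in>UNIV. (S i l)\<^sup>2) / 2"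
  proof -
    have "(\<Sum>i\<in>UNIV. \<Sum>l\<in>UNIV. S i l * pd \<Omega> i (\<lambda>z. V z $ l) y) = (\<Sum>i\<in>UNIV. \<Sum>l\<in>UNIV. S i l * pd \<Omega> l (\<lambda>z. V z $ i) y)"
      by (subst sum.swap) (simp add: Ssym)
    moreover have "(\<Sum>i\<in>UNIV. \<Sum>l\<in>UNIV. S i l * pd \<Omega> l (\<lambda>z. V z $ i) y) + (\<Sum>i\<in>UNIV. \<Sum>l\<in>UNIV. S i l * pd \<Omega> i (\<lambda>z. V z $ l) y)
      = (\<Sum>i\<in>UNIV. \<Sum>l\<in>UNIV. (S i l)\<^sup>2)"
      by (simp add: sum.distrib[symmetric] distrib_left[symmetric] S_def sym_jacobian_nth power2_eq_square)
    ultimately show ?thesis by linarith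
  qed
  ultimately show ?thesis using lap by (simp add: S_def)
qed

text \<open>
  A nonzero value would persist on a nonempty open set, which is not negligible.
\<close>
lemma continuous_nonneg_integral_0_imp_0:
  fixes f :: "'a::euclidean_space \<Rightarrow> real"
  assumes "open \<Omega>" "continuous_on \<Omega> f" and nonneg: "\<And>y. y \<in> \<Omega> \<Longrightarrow> f y \<ge> 0"
    and int: "has_bochner_integral lborel (\<lambda>y. indicator \<Omega> y * f y) 0" and y: "y \<in> \<Omega>"
  shows "f y = 0"
proof (rule ccontr)
  assume "f y \<noteq> 0"
  define U where "U = {z \<in> \<Omega>. f z \<noteq> 0}"
  have "U = \<Omega> \<inter> f -` (- {0})" by (auto simp: U_def)
  then have "open U" using continuous_open_preimage[OF assms(2,1) open_Compl[OF closed_singleton]] by simp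
  have "AE z in lborel. indicator \<Omega> z * f z = 0"
    using int by (subst integral_nonneg_eq_0_iff_AE[symmetric])
      (auto simp: has_bochner_integral_iff indicator_def nonneg)
  then have "AE z in lebesgue. z \<notin> U"
    by (intro AE_completion) (auto simp: U_def elim!: eventually_mono)
  then have "negligible U"
    unfolding negligible_iff_null_sets using \<open>open U\<close> by (subst AE_iff_null_sets) auto
  then show False using open_not_negligible[OF \<open>open U\<close>] y \<open>f y \<noteq> 0\<close> by (auto simp: U_def)
qed

text \<open>
  Integrating \<open>div (S V) = |S|\<^sup>2/2\<close>; the boundary term is \<open>\<langle>S V, \<nu>\<rangle> = 0\<close>. Fields with \<open>S = 0\<close> are the
  Killing fields, the velocity fields of rigid motions.
\<close>
lemma sym_jacobian_eq_0:
  fixes V :: "real ^ 'd::finite \<Rightarrow> real ^ 'd"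
  assumes "open \<Omega>" "bounded \<Omega>" "smooth_boundary \<Omega>"
    and normal: "\<And>z. z \<in> frontier \<Omega> \<Longrightarrow> outer_unit_normal_at \<Omega> z (\<nu> z)"
    and V: "vec_Ck_closure 2 \<Omega> V"
    and div: "\<And>z. z \<in> \<Omega> \<Longrightarrow> divergence \<Omega> V z = 0"
    and lap: "\<And>z. z \<in> \<Omega> \<Longrightarrow> vec_laplacian \<Omega> V z \<bullet> V z = 0"
    and tang: "\<And>z. z \<in> frontier \<Omega> \<Longrightarrow> (sym_jacobian \<Omega> V z *v V z) \<bullet> \<nu> z = 0"
    and x: "x \<in> closure \<Omega>"
  shows "sym_jacobian \<Omega> V x = 0"
proof (rule continuous_constant_on_closure[OF _ _ x])
  have "C1_closure_field \<Omega> V (jacobian \<Omega> V)"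
    using C1_closure_field_jacobian[OF assms(1), of 1] V by (simp add: numeral_2_eq_2)
  then have "continuous_on (closure \<Omega>) (jacobian \<Omega> V)" by (simp add: C1_closure_field_def)
  then show c: "continuous_on (closure \<Omega>) (sym_jacobian \<Omega> V)"
    unfolding sym_jacobian_def[abs_def] transpose_def by (intro continuous_intros)
  define f where "f y = (\<Sum>i\<in>UNIV. \<Sum>l\<in>UNIV. (sym_jacobian \<Omega> V y $ i $ l)\<^sup>2) / 2" for y
  have "has_bochner_integral lborel (\<lambda>y. indicator \<Omega> y * trace (sym_jacobian_image_deriv \<Omega> V y)) 0"
    by (rule integral_divergence_tangential_eq_0[OF assms(1-3) normal
          C1_closure_field_sym_jacobian_image[OF assms(1) V] tang])
  moreover have "indicator \<Omega> y * trace (sym_jacobian_image_deriv \<Omega> V y) = indicator \<Omega> y * f y" for y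
    using trace_sym_jacobian_image_deriv[OF assms(1) V _ div lap] by (auto simp: f_def indicator_def)
  ultimately have int: "has_bochner_integral lborel (\<lambda>y. indicator \<Omega> y * f y) 0" by simp
  fix y assume y: "y \<in> \<Omega>"
  have "f y = 0"
  proof (rule continuous_nonneg_integral_0_imp_0[OF assms(1) _ _ int y])
    show "continuous_on \<Omega> f"
      unfolding f_def by (intro continuous_intros continuous_on_subset[OF c closure_subset]) auto
    show "f z \<ge> 0" for z unfolding f_def by (intro divide_nonneg_pos sum_nonneg) auto
  qed
  then have "(\<Sum>i\<in>UNIV. \<Sum>l\<in>UNIV. (sym_jacobian \<Omega> V y $ i $ l)\<^sup>2) = 0" by (simp add: f_def)
  then have "\<forall>i l. sym_jacobian \<Omega> V y $ i $ l = 0"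
    by (simp add: sum_nonneg_eq_0_iff sum_nonneg)
  then show "sym_jacobian \<Omega> V y = 0" by (simp add: vec_eq_iff)
qed

section \<open>The normal derivative of the transported function\<close>

lemma grad_inner_eq_jacobian: "grad_inner \<Omega> F x v = jacobian \<Omega> F x *v v"
  by (simp add: grad_inner_def grad_def jacobian_def matrix_vector_mult_def inner_vec_def)

theorem lemma2p8:
  fixes \<Omega> :: "(real ^ 'd::finite) set"
    and \<nu> :: "real ^ 'd \<Rightarrow> real ^ 'd"
    and N :: nat
    and b :: "nat \<Rightarrow> real ^ 'd \<Rightarrow> real ^ 'd"
    and u :: "real ^ 'd \<Rightarrow> real"
  assumes "CARD('d) \<ge> 2"
    and "open \<Omega>" and "bounded \<Omega>" and "connected \<Omega>" and "\<Omega> \<noteq> {}"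
    and "smooth_boundary \<Omega>"
    and "\<forall>x\<in>frontier \<Omega>. outer_unit_normal_at \<Omega> x (\<nu> x)"
    and "N \<ge> 1"
    and "\<forall>i\<in>{1..N}. vec_Ck_closure 2 \<Omega> (b i)"
    and cond_i: "\<forall>i\<in>{1..N}. \<forall>x\<in>frontier \<Omega>. b i x \<bullet> \<nu> x = 0"
    and cond_ii: "N = 1 \<or>
      (\<forall>i\<in>{1..N}. \<forall>l\<in>{1..N}. i \<noteq> l \<longrightarrow>
        (\<forall>k j. \<forall>x\<in>closure \<Omega>.
          b i x $ k * pd \<Omega> k (\<lambda>y. b l y $ j) x = b l x $ k * pd \<Omega> k (\<lambda>y. b i y $ j) x))"
    and cond_iii: "\<forall>i\<in>{1..N}. \<forall>x\<in>closure \<Omega>.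
      divergence \<Omega> (b i) x = 0 \<and> vec_laplacian \<Omega> (b i) x \<bullet> b i x = 0"
    and cond_iv: "\<forall>i\<in>{1..N}. \<forall>x\<in>frontier \<Omega>.
      grad_inner \<Omega> (b i) x (\<nu> x) \<bullet> b i x + grad_inner \<Omega> (b i) x (b i x) \<bullet> \<nu> x = 0"
    and "Ck_closure 3 \<Omega> u"
    and "\<forall>x\<in>frontier \<Omega>. grad \<Omega> u x \<bullet> \<nu> x = 0"
  shows "\<forall>i\<in>{1..N}. \<forall>x\<in>frontier \<Omega>. grad \<Omega> (\<lambda>y. b i y \<bullet> grad \<Omega> u y) x \<bullet> \<nu> x = 0"
proof (intro ballI)
  fix i x assume i: "i \<in> {1..N}" and x: "x \<in> frontier \<Omega>"
  have op: "open \<Omega>" by fact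
  have normal: "outer_unit_normal_at \<Omega> z (\<nu> z)" if "z \<in> frontier \<Omega>" for z using assms(7) that by blast
  have xcl: "x \<in> closure \<Omega>" using x by (simp add: frontier_def)
  define J where "J = jacobian \<Omega> (b i)"
  define H where "H = jacobian \<Omega> (grad \<Omega> u)"
  have bC2: "vec_Ck_closure 2 \<Omega> (b i)" using assms(9) i by blast
  have Jb: "C1_closure_field \<Omega> (b i) J"
    unfolding J_def using C1_closure_field_jacobian[OF op, of 1] bC2 by (simp add: numeral_2_eq_2)
  have uC3: "Ck_closure (Suc (Suc (Suc 0))) \<Omega> u" using assms(14) by (simp add: numeral_3_eq_3)
  have Hu: "C1_closure_field \<Omega> (grad \<Omega> u) H"
    unfolding H_def by (rule C1_closure_field_jacobian[OF op vec_Ck_closure_grad[OF uC3]])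
  have Hsym: "transpose (H x) = H x"
    unfolding H_def by (rule jacobian_grad_symmetric[OF op uC3 xcl])
  have killing: "J x + transpose (J x) = 0"
    unfolding J_def sym_jacobian_def[symmetric]
  proof (rule sym_jacobian_eq_0[OF op assms(3,6) normal bC2 _ _ _ xcl])
    fix z assume z: "z \<in> frontier \<Omega>"
    then have "(jacobian \<Omega> (b i) z *v \<nu> z) \<bullet> b i z + (jacobian \<Omega> (b i) z *v b i z) \<bullet> \<nu> z = 0"
      using cond_iv i by (simp add: grad_inner_eq_jacobian)
    moreover have "(sym_jacobian \<Omega> (b i) z *v b i z) \<bullet> \<nu> z
        = (jacobian \<Omega> (b i) z *v b i z) \<bullet> \<nu> z + b i z \<bullet> (jacobian \<Omega> (b i) z *v \<nu> z)"
      by (simp only: sym_jacobian_def matrix_vector_mult_add_rdistrib inner_add_left inner_transpose)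
    ultimately show "(sym_jacobian \<Omega> (b i) z *v b i z) \<bullet> \<nu> z = 0"
      by (simp only: inner_commute[of "b i z"] add.commute)
  qed (use cond_iii i closure_subset[of \<Omega>] in auto)
  obtain r e \<rho> n M where "boundary_chart \<Omega> x r e \<rho> n M"
    by (rule smooth_boundary_chart[OF op assms(6) x])
  then interpret boundary_chart \<Omega> x r e \<rho> n M .
  have xb: "x \<in> ball x r" using r_pos by simp
  have orth: "w \<bullet> n z = 0" if "z \<in> ball x r" "z \<in> frontier \<Omega>" "w \<bullet> \<nu> z = 0" for w z
  proof -
    have "\<rho> z = 0" using frontier_iff that by blast
    from normal_parallel[OF that(1) this normal[OF that(2)]] obtain c where "c \<noteq> 0" "\<nu> z = c *\<^sub>R n z" .
    then show ?thesis using that(3) by auto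
  qed
  have bn: "b i z \<bullet> n z = 0" if "z \<in> ball x r" "z \<in> frontier \<Omega>" for z
    using orth[OF that] cond_i i that(2) by blast
  have un: "grad \<Omega> u z \<bullet> n z = 0" if "z \<in> ball x r" "z \<in> frontier \<Omega>" for z
    using orth[OF that] assms(15) that(2) by blast
  have 1: "(H x *v b i x) \<bullet> n x + grad \<Omega> u x \<bullet> (M x *v b i x) = 0"
    using bn[OF xb x] by (intro tangential_derivative_eq_0[OF Hu un xb x]) (auto simp: inner_commute)
  have 2: "(J x *v grad \<Omega> u x) \<bullet> n x + b i x \<bullet> (M x *v grad \<Omega> u x) = 0"
    using un[OF xb x] by (intro tangential_derivative_eq_0[OF Jb bn xb x]) (auto simp: inner_commute)
  note adj = inner_transpose[symmetric]
  \<comment> \<open>The curvature terms in the two previous equations agree because \<open>M x\<close> is symmetric\<close>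
  have 3: "(H x *v b i x) \<bullet> n x = (J x *v grad \<Omega> u x) \<bullet> n x"
    using 1 2 adj[of "b i x" "M x" "grad \<Omega> u x"] M_sym[of x] by (simp add: inner_commute)
  have "grad \<Omega> (\<lambda>y. b i y \<bullet> grad \<Omega> u y) x \<bullet> n x
      = (J x *v n x) \<bullet> grad \<Omega> u x + b i x \<bullet> (H x *v n x)"
    by (rule grad_inner_fields[OF op Jb Hu xcl])
  also have "b i x \<bullet> (H x *v n x) = (J x *v grad \<Omega> u x) \<bullet> n x"
    using 3 adj[of "b i x" "H x" "n x"] Hsym by simp
  also have "\<dots> = grad \<Omega> u x \<bullet> (transpose (J x) *v n x)"
    using adj[of "grad \<Omega> u x" "transpose (J x)" "n x"] by simp
  also have "(J x *v n x) \<bullet> grad \<Omega> u x + grad \<Omega> u x \<bullet> (transpose (J x) *v n x)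
      = grad \<Omega> u x \<bullet> ((J x + transpose (J x)) *v n x)"
    by (simp add: matrix_vector_mult_add_rdistrib inner_add_right inner_commute)
  also have "\<dots> = 0" by (simp add: killing)
  finally have "grad \<Omega> (\<lambda>y. b i y \<bullet> grad \<Omega> u y) x \<bullet> n x = 0" .
  moreover obtain c where "\<nu> x = c *\<^sub>R n x"
    using normal_parallel[OF xb _ normal[OF x]] frontier_iff[OF xb] x by blast
  ultimately show "grad \<Omega> (\<lambda>y. b i y \<bullet> grad \<Omega> u y) x \<bullet> \<nu> x = 0" by simp
qed

end
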